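(* Suppose $(A,B)$ is controllable, $(Q^{1/2},A)$ is observable, $B_w$ has full row rank, and $Q\succ0$, $R\succ0$. Then all stabilizing policies $K\in\mathcal{K}$ are non-degenerate with respect to the extended convex lifting $(\mathcal{L}_\infty,\mathcal{F}_\infty,\{0\},\Phi_\infty)$ of the state feedback $\mathcal{H}_\infty$ cost $J_\infty(K)=\|\mathbf{T}_{zw}(K,s)\|_{\mathcal{H}_\infty}$, $K\in\mathcal{K}$.
   Context: Setting: $A\in\mathbb{R}^{n\times n}$, $B\in\mathbb{R}^{n\times m}$, $B_w\in\mathbb{R}^{n\times n}$, $Q\in\mathbb{S}^n$, $R\in\mathbb{S}^m$. $\mathcal{K}=\{K\in\mathbb{R}^{m\times n}\mid\max_i\operatorname{Re}\lambda_i(A+BK)<0\}$. $\mathbf{T}_{zw}(K,s)=\begin{bmatrix}Q^{1/2}\\ R^{1/2}K\end{bmatrix}(sI-A-BK)^{-1}B_w$, and $\|\mathbf{T}\|_{\mathcal{H}_\infty}=\sup_{\omega\in\mathbb{R}}\sigma_{\max}(\mathbf{T}(j\omega))$. The ECL (extended convex lifting) consists of the lifted set $$\mathcal{L}_\infty=\left\{(K,\gamma,P)\ \middle|\ P\succ0,\ \begin{bmatrix}(A+BK)^{\mathsf T}P+P(A+BK)&PB_w&Q^{1/2}&K^{\mathsf T}R^{1/2}\\ B_w^{\mathsf T}P&-\gamma I&0&0\\ Q^{1/2}&0&-\gamma I&0\\ R^{1/2}K&0&0&-\gamma I\end{bmatrix}\preceq0\right\}$$ (with $K\in\mathbb{R}^{m\times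 n},\gamma\in\mathbb{R},P\in\mathbb{S}^n$), the convex set $$\mathcal{F}_\infty=\left\{(\gamma,Y,X)\ \middle|\ X\succ0,\ Y\in\mathbb{R}^{m\times n},\ \begin{bmatrix}AX+BY+XA^{\mathsf T}+Y^{\mathsf T}B^{\mathsf T}&B_w&XQ^{1/2}&Y^{\mathsf T}R^{1/2}\\ B_w^{\mathsf T}&-\gamma I&0&0\\ Q^{1/2}X&0&-\gamma I&0\\ R^{1/2}Y&0&0&-\gamma I\end{bmatrix}\preceq0\right\},$$ the trivial auxiliary set $\{0\}$ and the diffeomorphism $\Phi_\infty(K,\gamma,P)=(\gamma,KP^{-1},P^{-1})$ from $\mathcal{L}_\infty$ to $\mathcal{F}_\infty$. Non-degeneracy: $K\in\mathcal{K}$ is non-degenerate with respect to this ECL if $(K,J_\infty(K))\in\pi_{K,\gamma}(\mathcal{L}_\infty)$, i.e. if there exists $P$ such that $(K,J_\infty(K),P)\in\mathcal{L}_\infty$. *)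

theory Defs
  imports "HOL-Analysis.Analysis"
begin

definition hcat :: "'e^'c^'r \<Rightarrow> 'e^'d^'r \<Rightarrow> 'e^('c + 'd)^'r"  (infixr \<open>|||\<close> 62) where
  "M ||| N = (\<chi> i j. case j of Inl k \<Rightarrow> M $ i $ k | Inr k \<Rightarrow> N $ i $ k)"

definition vcat :: "'e^'c^'a \<Rightarrow> 'e^'c^'b \<Rightarrow> 'e^'c^('a + 'b)"  (infixr \<open>===\<close> 61) where
  "M === N = (\<chi> i. case i of Inl k \<Rightarrow> M $ k | Inr k \<Rightarrow> N $ k)"

definition symmetric_mat :: "real^'n^'n \<Rightarrow> bool" where
  "symmetric_mat M \<longleftrightarrow> transpose M = M"

definition pos_def :: "real^'n^'n \<Rightarrow> bool" where
  "pos_def M \<longleftrightarrow> symmetric_mat M \<and> (\<forall>x. x \<noteq> 0 \<longrightarrow> x \<bullet> (M *v x) > 0)"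

definition pos_semidef :: "real^'n^'n \<Rightarrow> bool" where
  "pos_semidef M \<longleftrightarrow> symmetric_mat M \<and> (\<forall>x. x \<bullet> (M *v x) \<ge> 0)"

definition neg_semidef :: "real^'n^'n \<Rightarrow> bool" where
  "neg_semidef M \<longleftrightarrow> symmetric_mat M \<and> (\<forall>x. x \<bullet> (M *v x) \<le> 0)"

text \<open>The principal square root; it is meaningful for positive semidefinite arguments only.\<close>

definition sqrt_mat :: "real^'n^'n \<Rightarrow> real^'n^'n" where
  "sqrt_mat M = (THE S. pos_semidef S \<and> S ** S = M)"

definition cmatrix :: "real^'c^'r \<Rightarrow> complex^'c^'r" where
  "cmatrix = map_matrix complex_of_real"

definition conj_transpose :: "complex^'c^'r \<Rightarrow> complex^'r^'c" where
  "conj_transpose M = (\<chi> i j. cnj (M $ j $ i))"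

definition eigenvalues :: "complex^'n^'n \<Rightarrow> complex set" where
  "eigenvalues M = {l. \<exists>v. v \<noteq> 0 \<and> M *v v = l *s v}"

definition singular_values :: "complex^'c^'r \<Rightarrow> real set" where
  "singular_values M =
     {\<sigma>. \<sigma> \<ge> 0 \<and> complex_of_real (\<sigma>\<^sup>2) \<in> eigenvalues (conj_transpose M ** M)}"

definition sigma_max :: "complex^'c^'r \<Rightarrow> real" where
  "sigma_max M = Max (singular_values M)"

definition spectral_abscissa :: "real^'n^'n \<Rightarrow> real" where
  "spectral_abscissa M = Max (Re ` eigenvalues (cmatrix M))"

definition piecewise_continuous_on :: "real \<Rightarrow> real \<Rightarrow> (real \<Rightarrow> 'a::topological_space) \<Rightarrow> bool"
  where
  "piecewise_continuous_on a b u \<longleftrightarrow>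
     (\<exists>S. finite S \<and> S \<subseteq> {a..b} \<and> continuous_on ({a..b} - S) u \<and>
        (\<forall>t\<in>S. (\<exists>l. (u \<longlongrightarrow> l) (at t within {a..<t})) \<and>
              (\<exists>r. (u \<longlongrightarrow> r) (at t within {t<..b}))))"

text \<open>A solution of \<open>x' = A x + B u\<close> on \<open>[0, T]\<close> under a piecewise continuous input is
  continuous and satisfies the differential equation off a finite set of times.\<close>

definition state_trajectory ::
  "real^'n^'n \<Rightarrow> real^'m^'n \<Rightarrow> real \<Rightarrow> (real \<Rightarrow> real^'m) \<Rightarrow> (real \<Rightarrow> real^'n) \<Rightarrow> bool" where
  "state_trajectory A B T u x \<longleftrightarrow>
     piecewise_continuous_on 0 T u \<and> continuous_on {0..T} x \<and>
     (\<exists>S. finite S \<and>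
        (\<forall>t\<in>{0..T} - S. (x has_vector_derivative (A *v x t + B *v u t)) (at t within {0..T})))"

definition controllable :: "real^'n^'n \<Rightarrow> real^'m^'n \<Rightarrow> bool" where
  "controllable A B \<longleftrightarrow>
     (\<forall>x0 x1. \<forall>T>0. \<exists>u x. state_trajectory A B T u x \<and> x 0 = x0 \<and> x T = x1)"

text \<open>The initial state is determined by the output \<open>y = C x\<close> on \<open>[0, T]\<close>. A known input shifts all
  outputs by the same function and so plays no role: the system considered is \<open>x' = A x\<close>.\<close>

definition observable :: "real^'n^'p \<Rightarrow> real^'n^'n \<Rightarrow> bool" where
  "observable C A \<longleftrightarrow>
     (\<forall>T>0. \<forall>x z.
        (\<forall>t\<in>{0..T}. (x has_vector_derivative (A *v x t)) (at t within {0..T})) \<and>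
        (\<forall>t\<in>{0..T}. (z has_vector_derivative (A *v z t)) (at t within {0..T})) \<and>
        (\<forall>t\<in>{0..T}. C *v x t = C *v z t)
        \<longrightarrow> x 0 = z 0)"

definition stabilizing :: "real^'n^'n \<Rightarrow> real^'m^'n \<Rightarrow> (real^'n^'m) set" where
  "stabilizing A B = {K. spectral_abscissa (A + B ** K) < 0}"

definition T_zw ::
  "real^'n^'n \<Rightarrow> real^'m^'n \<Rightarrow> real^'n^'n \<Rightarrow> real^'n^'n \<Rightarrow> real^'m^'m \<Rightarrow>
   real^'n^'m \<Rightarrow> complex \<Rightarrow> complex^'n^('n + 'm)" where
  "T_zw A B Bw Q R K s =
     cmatrix (sqrt_mat Q === sqrt_mat R ** K) **
     matrix_inv (mat s - cmatrix A - cmatrix B ** cmatrix K) ** cmatrix Bw"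

text \<open>The supremum is taken in the reals. For a stable transfer function such as that of a
  stabilizing \<open>K\<close> the frequency response is bounded, so this is the usual norm.\<close>

definition hinf_norm :: "(complex \<Rightarrow> complex^'c^'r) \<Rightarrow> real" where
  "hinf_norm T = (SUP \<omega>::real. sigma_max (T (\<i> * complex_of_real \<omega>)))"

definition J_inf ::
  "real^'n^'n \<Rightarrow> real^'m^'n \<Rightarrow> real^'n^'n \<Rightarrow> real^'n^'n \<Rightarrow> real^'m^'m \<Rightarrow>
   real^'n^'m \<Rightarrow> real" where
  "J_inf A B Bw Q R K = hinf_norm (T_zw A B Bw Q R K)"

definition L_inf ::
  "real^'n^'n \<Rightarrow> real^'m^'n \<Rightarrow> real^'n^'n \<Rightarrow> real^'n^'n \<Rightarrow> real^'m^'m \<Rightarrow>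
   ((real^'n^'m) \<times> real \<times> (real^'n^'n)) set" where
  "L_inf A B Bw Q R = {(K, \<gamma>, P). pos_def P \<and> neg_semidef (
      (transpose (A + B ** K) ** P + P ** (A + B ** K)
                          ||| P ** Bw         ||| sqrt_mat Q    ||| transpose K ** sqrt_mat R)
  === (transpose Bw ** P  ||| (-\<gamma>) *\<^sub>R mat 1  ||| 0             ||| 0)
  === (sqrt_mat Q         ||| 0               ||| (-\<gamma>) *\<^sub>R mat 1 ||| 0)
  === (sqrt_mat R ** K    ||| 0               ||| 0             ||| (-\<gamma>) *\<^sub>R mat 1))}"

definition F_inf ::
  "real^'n^'n \<Rightarrow> real^'m^'n \<Rightarrow> real^'n^'n \<Rightarrow> real^'n^'n \<Rightarrow> real^'m^'m \<Rightarrow>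
   (real \<times> (real^'n^'m) \<times> (real^'n^'n)) set" where
  "F_inf A B Bw Q R = {(\<gamma>, Y, X). pos_def X \<and> neg_semidef (
      (A ** X + B ** Y + X ** transpose A + transpose Y ** transpose B
                          ||| Bw              ||| X ** sqrt_mat Q    ||| transpose Y ** sqrt_mat R)
  === (transpose Bw       ||| (-\<gamma>) *\<^sub>R mat 1  ||| 0             ||| 0)
  === (sqrt_mat Q ** X    ||| 0               ||| (-\<gamma>) *\<^sub>R mat 1 ||| 0)
  === (sqrt_mat R ** Y    ||| 0               ||| 0             ||| (-\<gamma>) *\<^sub>R mat 1))}"

definition Phi_inf ::
  "(real^'n^'m) \<times> real \<times> (real^'n^'n) \<Rightarrow> real \<times> (real^'n^'m) \<times> (real^'n^'n)" where
  "Phi_inf = (\<lambda>(K, \<gamma>, P). (\<gamma>, K ** matrix_inv P, matrix_inv P))"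

record ('k, 'p, 'f, 'g) convex_lifting =
  lifted_set :: "('k \<times> real \<times> 'p) set"
  convex_set :: "'f set"
  auxiliary_set :: "'g set"
  lifting_map :: "'k \<times> real \<times> 'p \<Rightarrow> 'f"

definition ecl_inf ::
  "real^'n^'n \<Rightarrow> real^'m^'n \<Rightarrow> real^'n^'n \<Rightarrow> real^'n^'n \<Rightarrow> real^'m^'m \<Rightarrow>
   (real^'n^'m, real^'n^'n, real \<times> (real^'n^'m) \<times> (real^'n^'n), real) convex_lifting" where
  "ecl_inf A B Bw Q R =
     \<lparr>lifted_set = L_inf A B Bw Q R, convex_set = F_inf A B Bw Q R,
      auxiliary_set = {0}, lifting_map = Phi_inf\<rparr>"

definition nondegenerate ::
  "('k, 'p, 'f, 'g) convex_lifting \<Rightarrow> ('k \<Rightarrow> real) \<Rightarrow> 'k \<Rightarrow> bool" where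
  "nondegenerate E J K \<longleftrightarrow> (K, J K) \<in> (\<lambda>(K, \<gamma>, P). (K, \<gamma>)) ` lifted_set E"

end

theory Submission
  imports Defs "HOL-Computational_Algebra.Fundamental_Theorem_Algebra"
begin

text \<open>
  Write \<open>M = A + B K\<close>, \<open>C\<close> for the matrix with the blocks \<open>Q\<^sup>1\<^sup>/\<^sup>2\<close> and \<open>R\<^sup>1\<^sup>/\<^sup>2 K\<close>, and
  \<open>g = J\<^sub>\<infinity>(K)\<close>. The claim is the bounded real lemma in its non-strict form, at the exact value
  \<open>g\<close> of the norm. Eliminating the last two block variables turns the matrix inequality into
  \<open>2 (M x + B\<^sub>w w) \<bullet> P x + |C x|\<^sup>2 / g \<le> g |w|\<^sup>2\<close> for all \<open>x\<close> and \<open>w\<close>. As \<open>B\<^sub>w\<close> is square of full rank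
  it is invertible, so the velocity \<open>v = M x + B\<^sub>w w\<close> may replace \<open>w\<close> as the free variable. The
  inequality then says that the quadratic form
  \<open>q(x, v) = g |B\<^sub>w\<^sup>-\<^sup>1 (v - M x)|\<^sup>2 - |C x|\<^sup>2 / g\<close> dominates \<open>2 v \<bullet> P x\<close>.

  The definition of \<open>g\<close> gives exactly that the Hermitian extension of \<open>q\<close> is nonnegative at
  \<open>(x, \<i>\<omega>x)\<close> for all real \<open>\<omega>\<close> and complex \<open>x\<close> (lemma \<open>norm_response_le_hinf_norm\<close>; the frequency
  response of a stable system is bounded, so the supremum is a genuine one). From this a symmetric
  \<open>P\<close> is obtained by convex duality, as in Rantzer's proof of the Kalman-Yakubovich-Popov lemma. If
  the perturbed form \<open>q + d (|x|\<^sup>2 + |v|\<^sup>2)\<close> admitted no \<open>P\<close>, a separation argument would produce vectors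
  \<open>(a\<^sub>j, b\<^sub>j)\<close> with \<open>\<Sum>\<^sub>j a\<^sub>j b\<^sub>j\<^sup>T\<close> skew-symmetric and a nonpositive sum of values of the perturbed form.
  But for such vectors \<open>\<Sum>\<^sub>j q(a\<^sub>j, b\<^sub>j) \<ge> 0\<close>: up to a nonnegative remainder the sum is a trace, which
  splits along the rotation planes of a skew operator \<open>J\<close> into values of \<open>q\<close> at points
  \<open>(x, \<i>\<omega>x)\<close> (lemma \<open>sum_form_skew_nonneg\<close>). The matrices \<open>P\<close> that
  belong to \<open>d = 1, 1/2, 1/3, \<dots>\<close> form a decreasing sequence of nonempty compact sets, where boundedness
  holds because \<open>v\<close> and \<open>-v\<close> are both admissible; a common element serves for \<open>d = 0\<close>
  (lemma \<open>kyp_lemma\<close>).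

  Finally \<open>P\<close> is positive definite. Putting \<open>w = 0\<close> gives \<open>x \<bullet> P M x < 0\<close> for \<open>x \<noteq> 0\<close>, because
  \<open>Q\<^sup>1\<^sup>/\<^sup>2\<close> is injective. As \<open>M\<close> is stable, a product \<open>(M - l\<^sub>1) \<cdots> (M - l\<^sub>k)\<close> over
  eigenvalues vanishes, which yields an explicit inner product \<open>b\<close> with \<open>b(x, M x) \<le> 0\<close>
  (lemma \<open>ex_lyapunov_form\<close>). Comparing \<open>P\<close> with \<open>b\<close> at a minimum of \<open>(x \<bullet> P x) / b(x, x)\<close> shows
  that this minimum is positive (lemma \<open>lyapunov_positive\<close>).
\<close>

section \<open>Self-adjoint operators\<close>

text \<open>A null vector of a positive semidefinite form lies in its radical.\<close>

lemma psd_form_null_vector: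
  fixes h :: "'a::real_vector \<Rightarrow> 'a \<Rightarrow> real"
  assumes h: "bilinear h" and sym: "\<And>x y. h x y = h y x"
    and V: "subspace V" and nonneg: "\<And>x. x \<in> V \<Longrightarrow> h x x \<ge> 0"
    and x: "x \<in> V" "h x x = 0" and y: "y \<in> V"
  shows "h x y = 0"
proof (rule ccontr)
  assume c: "h x y \<noteq> 0"
  \<comment> \<open>The polynomial \<open>2 t c + t\<^sup>2 d\<close> is negative at \<open>t = - c / (d + 1)\<close>, unless \<open>c = 0\<close>.\<close>
  define c d k where "c = h x y" and "d = h y y" and "k = d + 1"
  have k: "k \<ge> 1" unfolding d_def k_def using nonneg[OF y] by simp
  have *: "0 \<le> 2 * t * c + t\<^sup>2 * d" for t
  proof -
    have "x + t *\<^sub>R y \<in> V"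
      using V x y by (simp add: subspace_add subspace_scale)
    from nonneg[OF this] show ?thesis
      using x(2) sym[of y x]
      by (simp add: bilinear_ladd[OF h] bilinear_radd[OF h] bilinear_lmul[OF h] bilinear_rmul[OF h]
          c_def d_def power2_eq_square algebra_simps)
  qed
  have "2 * (- c / k) * c + (- c / k)\<^sup>2 * (k - 1) = - (c\<^sup>2 / k) - (c / k)\<^sup>2"
    using k by (simp add: field_simps power2_eq_square)
  moreover have "c\<^sup>2 / k > 0"
    using c k by (simp add: c_def)
  ultimately show False
    using *[of "- c / k"] k_def by (simp add: not_le[symmetric]) (smt (verit) zero_le_power2)
qed

lemma selfadjoint_eigenvector:
  fixes f :: "'a::euclidean_space \<Rightarrow> 'a"
  assumes f: "linear f" and sa: "\<And>x y. f x \<bullet> y = x \<bullet> f y"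
    and V: "subspace V" and inv: "\<And>x. x \<in> V \<Longrightarrow> f x \<in> V" and "V \<noteq> {0}"
  obtains e where "e \<in> V" "norm e = 1" "f e = (e \<bullet> f e) *\<^sub>R e"
    "\<And>x. x \<in> V \<Longrightarrow> x \<bullet> f x \<le> (e \<bullet> f e) * (norm x)\<^sup>2"
proof -
  let ?K = "V \<inter> sphere 0 1"
  have "compact ?K"
    using closed_subspace[OF V] by (simp add: closed_Int_compact)
  obtain z where z: "z \<in> V" "z \<noteq> 0"
    using \<open>V \<noteq> {0}\<close> subspace_0[OF V] by auto
  then have "z /\<^sub>R norm z \<in> ?K"
    using V by (simp add: subspace_scale)
  then have "?K \<noteq> {}" by blast
  have "continuous_on ?K (\<lambda>x. x \<bullet> f x)"
    by (intro continuous_intros linear_continuous_on) (simp add: f linear_conv_bounded_linear[symmetric])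
  from continuous_attains_sup[OF \<open>compact ?K\<close> \<open>?K \<noteq> {}\<close> this]
  obtain e where e: "e \<in> V" "norm e = 1" and max: "\<And>y. y \<in> ?K \<Longrightarrow> y \<bullet> f y \<le> e \<bullet> f e"
    by auto
  define l where "l = e \<bullet> f e"
  have bound: "x \<bullet> f x \<le> l * (norm x)\<^sup>2" if "x \<in> V" for x
  proof (cases "x = 0")
    case False
    then have "x /\<^sub>R norm x \<in> ?K"
      using V that by (simp add: subspace_scale)
    from max[OF this] show ?thesis
      using False by (simp add: linear_scale[OF f] l_def power2_eq_square field_simps)
  qed (use linear_0[OF f] in simp)
  \<comment> \<open>The form \<open>l |x|\<^sup>2 - x \<bullet> f x\<close> is nonnegative on \<open>V\<close> and vanishes at the maximizer \<open>e\<close>, so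
    \<open>l e - f e\<close> is orthogonal to \<open>V\<close>, to which it belongs.\<close>
  define h where "h x y = l * (x \<bullet> y) - x \<bullet> f y" for x y
  have "bilinear h"
    unfolding bilinear_def linear_iff h_def
    by (simp add: inner_add inner_diff linear_add[OF f] linear_scale[OF f] algebra_simps)
  moreover have "h x y = h y x" for x y
    unfolding h_def using sa[of x y] by (simp add: inner_commute)
  moreover have "h x x \<ge> 0" if "x \<in> V" for x
    using bound[OF that] by (simp add: h_def dot_square_norm)
  moreover have "h e e = 0"
    using e by (simp add: h_def l_def dot_square_norm)
  moreover have "l *\<^sub>R e - f e \<in> V"
    using V e inv by (simp add: subspace_diff subspace_scale)
  ultimately have "h e (l *\<^sub>R e - f e) = 0"
    using psd_form_null_vector[of h V e] V e by blast
  moreover have "h e y = (l *\<^sub>R e - f e) \<bullet> y" for y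
    by (simp add: h_def inner_diff sa)
  ultimately have "f e = l *\<^sub>R e"
    by simp
  then show thesis
    using that e bound by (simp add: l_def)
qed

text \<open>The spectral theorem for a self-adjoint operator, relative to an invariant subspace so that
  it can be proved by splitting off one eigenvector at a time.\<close>

lemma selfadjoint_eigenbasis_subspace:
  fixes f :: "'a::euclidean_space \<Rightarrow> 'a"
  assumes f: "linear f" and sa: "\<And>x y. f x \<bullet> y = x \<bullet> f y"
    and "subspace V" and "\<And>x. x \<in> V \<Longrightarrow> f x \<in> V"
  shows "\<exists>E. finite E \<and> span E = V \<and> pairwise orthogonal E \<and> (\<forall>e\<in>E. norm e = 1) \<and>
    (\<forall>e\<in>E. f e = (e \<bullet> f e) *\<^sub>R e)"
  using assms(3,4)
proof (induction "dim V" arbitrary: V rule: less_induct)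
  case less
  show ?case
  proof (cases "V = {0}")
    case True
    then show ?thesis by (intro exI[of _ "{}"]) auto
  next
    case False
    obtain e where e: "e \<in> V" "norm e = 1" "f e = (e \<bullet> f e) *\<^sub>R e"
      using selfadjoint_eigenvector[OF f sa less.prems False] by metis
    define W where "W = {y \<in> V. e \<bullet> y = 0}"
    have W: "subspace W"
      using less.prems(1) unfolding W_def subspace_def by (auto simp: inner_add)
    have invW: "f x \<in> W" if "x \<in> W" for x
    proof -
      have "e \<bullet> f x = f e \<bullet> x" by (simp add: sa)
      also have "\<dots> = 0" using that e(3) by (metis (mono_tags, lifting) W_def inner_scaleR_left mem_Collect_eq mult_zero_right)
      finally show ?thesis using that less.prems by (simp add: W_def)
    qed
    have "e \<notin> W" using e by (simp add: W_def dot_square_norm)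
    moreover have "W \<subseteq> V" by (auto simp: W_def)
    ultimately have "W \<subset> V" using e(1) by blast
    then have "dim W < dim V"
      using W less.prems(1) by (metis dim_psubset span_eq_iff)
    from less.hyps[OF this W invW] obtain E where E: "finite E" "span E = W" "pairwise orthogonal E"
      "\<forall>e\<in>E. norm e = 1" "\<forall>e\<in>E. f e = (e \<bullet> f e) *\<^sub>R e" by blast
    have EW: "E \<subseteq> W" using E(2) span_superset by blast
    have "span (insert e E) = V"
    proof
      show "span (insert e E) \<subseteq> V"
        using EW e(1) less.prems(1) by (intro span_minimal) (auto simp: W_def)
      show "V \<subseteq> span (insert e E)"
      proof
        fix v assume v: "v \<in> V"
        have "v - (e \<bullet> v) *\<^sub>R e \<in> W"
          using v e less.prems(1) by (simp add: W_def subspace_diff subspace_scale inner_diff dot_square_norm)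
        then show "v \<in> span (insert e E)"
          using E(2) by (auto simp: span_insert)
      qed
    qed
    moreover have "pairwise orthogonal (insert e E)"
      using E(3) EW by (intro pairwise_orthogonal_insert) (auto simp: W_def orthogonal_def)
    ultimately show ?thesis
      using E e by (intro exI[of _ "insert e E"]) auto
  qed
qed

text \<open>An orthonormal basis of the whole space, as an unordered set.\<close>

definition orthonormal_basis :: "'a::euclidean_space set \<Rightarrow> bool" where
  "orthonormal_basis E \<longleftrightarrow>
     finite E \<and> span E = UNIV \<and> pairwise orthogonal E \<and> (\<forall>e\<in>E. norm e = 1)"

lemma orthonormal_basis_expansion:
  "orthonormal_basis E \<Longrightarrow> (\<Sum>e\<in>E. (e \<bullet> y) *\<^sub>R e) = y"
  using orthonormal_basis_expand[of E y] by (simp add: orthonormal_basis_def inner_commute)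

lemma orthonormal_basis_inner:
  "orthonormal_basis E \<Longrightarrow> e \<in> E \<Longrightarrow> e' \<in> E \<Longrightarrow> e \<bullet> e' = (if e = e' then 1 else 0)"
  by (auto simp: orthonormal_basis_def pairwise_def orthogonal_def dot_square_norm)

theorem selfadjoint_eigenbasis:
  fixes f :: "'a::euclidean_space \<Rightarrow> 'a"
  assumes "linear f" and "\<And>x y. f x \<bullet> y = x \<bullet> f y"
  obtains E where "orthonormal_basis E" "\<And>e. e \<in> E \<Longrightarrow> f e = (e \<bullet> f e) *\<^sub>R e"
  using selfadjoint_eigenbasis_subspace[OF assms, of UNIV] by (auto simp: orthonormal_basis_def)

text \<open>An orthonormal family indexed by an orthonormal basis has the right size to be a basis.\<close>

lemma orthonormal_family_basis:
  fixes f :: "'a::euclidean_space \<Rightarrow> 'a"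
  assumes E: "orthonormal_basis E"
    and f: "\<And>e e'. e \<in> E \<Longrightarrow> e' \<in> E \<Longrightarrow> f e \<bullet> f e' = (if e = e' then 1 else 0)"
  shows "inj_on f E" and "orthonormal_basis (f ` E)"
proof -
  show inj: "inj_on f E"
    using f by (metis inj_onI zero_neq_one)
  have ind: "independent F" if "pairwise orthogonal F" "\<forall>e\<in>F. norm e = 1" for F :: "'a set"
    using that by (intro pairwise_orthogonal_independent) auto
  have "card E = DIM('a)"
    using E ind[of E] unfolding orthonormal_basis_def
    by (metis dim_UNIV indep_card_eq_dim_span)
  then have card: "card (f ` E) = DIM('a)"
    by (simp add: card_image inj)
  have orth: "pairwise orthogonal (f ` E)"
    using f by (auto simp: pairwise_def orthogonal_def)
  have norm: "\<forall>e\<in>f ` E. norm e = 1"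
    using f by (auto simp: norm_eq_1)
  have "span (f ` E) = UNIV"
    using card_eq_dim[of "f ` E" UNIV] card ind[OF orth norm] E
    by (auto simp: orthonormal_basis_def)
  then show "orthonormal_basis (f ` E)"
    using E orth norm by (simp add: orthonormal_basis_def)
qed

text \<open>A positive definite operator \<open>f\<close> has a square root \<open>s\<close>, with inverse \<open>t\<close>.\<close>

lemma selfadjoint_sqrt:
  fixes f :: "'a::euclidean_space \<Rightarrow> 'a"
  assumes f: "linear f" and sa: "\<And>x y. f x \<bullet> y = x \<bullet> f y"
    and pos: "\<And>x. x \<noteq> 0 \<Longrightarrow> x \<bullet> f x > 0"
  obtains s t where "linear s" "\<And>x y. s x \<bullet> y = x \<bullet> s y" "\<And>x. x \<bullet> s x \<ge> 0" "\<And>x. s (s x) = f x"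
    "linear t" "\<And>x y. t x \<bullet> y = x \<bullet> t y" "\<And>x. s (t x) = x" "\<And>x. t (s x) = x"
proof -
  obtain E where E: "orthonormal_basis E" and eig: "\<And>e. e \<in> E \<Longrightarrow> f e = (e \<bullet> f e) *\<^sub>R e"
    using selfadjoint_eigenbasis[OF f sa] by blast
  have fin: "finite E" using E by (simp add: orthonormal_basis_def)
  define l where "l e = e \<bullet> f e" for e
  have l: "l e > 0" if "e \<in> E" for e
    using pos[of e] that E by (force simp: l_def orthonormal_basis_def)
  \<comment> \<open>\<open>D c\<close> is the operator that is diagonal in the basis \<open>E\<close> with entries \<open>c\<close>.\<close>
  define D where "D c x = (\<Sum>e\<in>E. (c e * (e \<bullet> x)) *\<^sub>R e)" for c :: "'a \<Rightarrow> real" and x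
  have lin: "linear (D c)" for c
    by (simp add: linear_iff D_def inner_add scaleR_add_left sum.distrib scaleR_sum_right algebra_simps)
  have sym: "D c x \<bullet> y = x \<bullet> D c y" for c x y
    by (simp add: D_def inner_sum_left inner_sum_right inner_commute mult_ac)
  have dot: "e \<bullet> D c x = c e * (e \<bullet> x)" if "e \<in> E" for e c x
  proof -
    have "e \<bullet> D c x = (\<Sum>e'\<in>E. if e' = e then c e * (e \<bullet> x) else 0)"
      unfolding D_def inner_sum_right
      by (rule sum.cong) (auto simp: orthonormal_basis_inner[OF E \<open>e \<in> E\<close>])
    then show ?thesis using fin that by simp
  qed
  have comp: "D c (D d x) = D (\<lambda>e. c e * d e) x" for c d x
    unfolding D_def[of c] D_def[of "\<lambda>e. c e * d e"]
    by (rule sum.cong) (auto simp: dot mult_ac)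
  have one: "D c x = x" if "\<And>e. e \<in> E \<Longrightarrow> c e = 1" for c x
    using orthonormal_basis_expansion[OF E, of x] that by (simp add: D_def)
  have Dl: "D c x = f x" if "\<And>e. e \<in> E \<Longrightarrow> c e = l e" for c x
  proof -
    have "f x = (\<Sum>e\<in>E. (e \<bullet> x) *\<^sub>R f e)"
      using orthonormal_basis_expansion[OF E, of x, symmetric]
      by (metis (no_types, lifting) f linear_sum linear_scale sum.cong)
    also have "\<dots> = D c x"
      unfolding D_def using eig that by (intro sum.cong) (auto simp: l_def, metis scaleR_scaleR mult.commute)
    finally show ?thesis by simp
  qed
  show thesis
  proof (rule that[of "D (\<lambda>e. sqrt (l e))" "D (\<lambda>e. inverse (sqrt (l e)))"])
    show "x \<bullet> D (\<lambda>e. sqrt (l e)) x \<ge> 0" for x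
    proof -
      have "x \<bullet> D (\<lambda>e. sqrt (l e)) x = (\<Sum>e\<in>E. sqrt (l e) * (e \<bullet> x)\<^sup>2)"
        by (simp add: D_def inner_sum_right inner_commute power2_eq_square mult.assoc)
      then show ?thesis using l by (auto intro!: sum_nonneg simp: less_imp_le)
    qed
    show "D (\<lambda>e. sqrt (l e)) (D (\<lambda>e. sqrt (l e)) x) = f x" for x
      unfolding comp by (rule Dl) (use l in \<open>auto intro!: real_sqrt_mult_self simp: less_imp_le\<close>)
    show "D (\<lambda>e. sqrt (l e)) (D (\<lambda>e. inverse (sqrt (l e))) x) = x" for x
      unfolding comp by (rule one) (use l in force)
    show "D (\<lambda>e. inverse (sqrt (l e))) (D (\<lambda>e. sqrt (l e)) x) = x" for x
      unfolding comp by (rule one) (use l in force)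
  qed (fact lin sym)+
qed

section \<open>Sums of a quadratic form over a skew family\<close>

lemma sum_bilinear_eq_sum_Basis:
  fixes h :: "'a::euclidean_space \<Rightarrow> 'b::real_vector \<Rightarrow> real"
  assumes h: "bilinear h"
  shows "(\<Sum>j\<in>I. h (a j) (b j)) = (\<Sum>i\<in>Basis. h i (\<Sum>j\<in>I. (a j \<bullet> i) *\<^sub>R b j))"
proof -
  have lin: "linear (\<lambda>x. h x y)" "linear (h x)" for x y
    using h by (auto simp: bilinear_def)
  have "h (a j) (b j) = (\<Sum>i\<in>Basis. h i ((a j \<bullet> i) *\<^sub>R b j))" for j
  proof -
    have "h (a j) (b j) = h (\<Sum>i\<in>Basis. (a j \<bullet> i) *\<^sub>R i) (b j)"
      by (simp add: euclidean_representation)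
    also have "\<dots> = (\<Sum>i\<in>Basis. h i ((a j \<bullet> i) *\<^sub>R b j))"
      by (simp add: linear_sum[OF lin(1)] bilinear_lmul[OF h] bilinear_rmul[OF h])
    finally show ?thesis .
  qed
  then have "(\<Sum>j\<in>I. h (a j) (b j)) = (\<Sum>j\<in>I. \<Sum>i\<in>Basis. h i ((a j \<bullet> i) *\<^sub>R b j))"
    by (intro sum.cong refl)
  also have "\<dots> = (\<Sum>i\<in>Basis. \<Sum>j\<in>I. h i ((a j \<bullet> i) *\<^sub>R b j))"
    by (rule sum.swap)
  also have "\<dots> = (\<Sum>i\<in>Basis. h i (\<Sum>j\<in>I. (a j \<bullet> i) *\<^sub>R b j))"
    by (rule sum.cong) (simp_all only: linear_sum[OF lin(2)])
  finally show ?thesis .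
qed

text \<open>The value \<open>\<Sum>\<^sub>j h(a\<^sub>j, b\<^sub>j)\<close> depends only on the operator \<open>\<Sum>\<^sub>j b\<^sub>j a\<^sub>j\<^sup>T\<close>.\<close>

lemma bilinear_sum_eq:
  fixes h :: "'a::euclidean_space \<Rightarrow> 'b::real_vector \<Rightarrow> real"
  assumes h: "bilinear h"
    and eq: "\<And>y. (\<Sum>j\<in>I. (a j \<bullet> y) *\<^sub>R b j) = (\<Sum>k\<in>L. (c k \<bullet> y) *\<^sub>R d k)"
  shows "(\<Sum>j\<in>I. h (a j) (b j)) = (\<Sum>k\<in>L. h (c k) (d k))"
  unfolding sum_bilinear_eq_sum_Basis[OF h, of a b I] sum_bilinear_eq_sum_Basis[OF h, of c d L] eq ..

lemma bilinear_compose: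
  assumes h: "bilinear h" and "linear f" "linear g"
  shows "bilinear (\<lambda>x y. h (f x) (g y))"
  using assms linear_compose[of f "\<lambda>x. h x _"] linear_compose[of g "h _"]
  by (auto simp: bilinear_def o_def)

text \<open>
  The assumption \<open>fdi\<close> is the frequency domain inequality in real terms: it evaluates the Hermitian
  extension of the form at \<open>(c, \<i>\<omega>c)\<close>, where \<open>c = x + \<i>y\<close>. The assumption \<open>skew\<close> says
  that \<open>\<Sum>\<^sub>j a\<^sub>j b\<^sub>j\<^sup>T\<close> is skew-symmetric. The covariance \<open>X = \<Sum>\<^sub>j a\<^sub>j a\<^sub>j\<^sup>T\<close> is first taken to be invertible.
  With \<open>N = \<Sum>\<^sub>j b\<^sub>j a\<^sub>j\<^sup>T\<close>, the best linear prediction of \<open>b\<^sub>j\<close> from \<open>a\<^sub>j\<close> is \<open>K a\<^sub>j\<close>, where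
  \<open>K = N X\<^sup>-\<^sup>1\<close>. For \<open>s = X\<^sup>1\<^sup>/\<^sup>2\<close> the operator \<open>J = s\<^sup>-\<^sup>1 K s\<close> is skew.
\<close>

lemma sum_form_skew_nonneg_nondeg:
  fixes h :: "'a::euclidean_space \<times> 'a \<Rightarrow> 'a \<times> 'a \<Rightarrow> real" and a b :: "'i \<Rightarrow> 'a"
  assumes h: "bilinear h" and hsym: "\<And>z w. h z w = h w z"
    and h0: "\<And>v. h (0, v) (0, v) \<ge> 0"
    and fdi: "\<And>w x y. h (x, - w *\<^sub>R y) (x, - w *\<^sub>R y) + h (y, w *\<^sub>R x) (y, w *\<^sub>R x) \<ge> 0"
    and skew: "\<And>y z. (\<Sum>j\<in>I. (a j \<bullet> y) * (b j \<bullet> z)) = - (\<Sum>j\<in>I. (a j \<bullet> z) * (b j \<bullet> y))"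
    and nondeg: "\<And>y. y \<noteq> 0 \<Longrightarrow> (\<Sum>j\<in>I. (a j \<bullet> y)\<^sup>2) > 0"
  shows "(\<Sum>j\<in>I. h (a j, b j) (a j, b j)) \<ge> 0"
proof -
  define X where "X y = (\<Sum>j\<in>I. (a j \<bullet> y) *\<^sub>R a j)" for y
  define N where "N y = (\<Sum>j\<in>I. (a j \<bullet> y) *\<^sub>R b j)" for y
  have "linear X"
    by (simp add: linear_iff X_def inner_add scaleR_add_left sum.distrib scaleR_sum_right)
  have N: "linear N"
    by (simp add: linear_iff N_def inner_add scaleR_add_left sum.distrib scaleR_sum_right)
  have Nskew: "N y \<bullet> z = - (y \<bullet> N z)" for y z
    using skew[of y z] by (simp add: N_def inner_sum_left inner_sum_right inner_commute)
  have X: "X y \<bullet> z = y \<bullet> X z" for y z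
    by (simp add: X_def inner_sum_left inner_sum_right inner_commute mult.commute)
  have Xpos: "y \<bullet> X y > 0" if "y \<noteq> 0" for y
    using nondeg[OF that] by (simp add: X_def inner_sum_right inner_commute power2_eq_square)
  obtain s t where s: "linear s" "\<And>x y. s x \<bullet> y = x \<bullet> s y" "\<And>x. x \<bullet> s x \<ge> 0"
      "\<And>x. s (s x) = X x"
    and t: "linear t" "\<And>x y. t x \<bullet> y = x \<bullet> t y" and st: "\<And>x. s (t x) = x" "\<And>x. t (s x) = x"
    using selfadjoint_sqrt[OF \<open>linear X\<close> X Xpos] by blast
  define K where "K x = N (t (t x))" for x
  define J where "J x = t (N (t x))" for x
  have K: "linear K"
    using linear_compose[OF linear_compose[OF t(1) t(1)] N] by (simp add: K_def[abs_def] o_def)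
  have J: "linear J"
    using linear_compose[OF linear_compose[OF t(1) N] t(1)] by (simp add: J_def[abs_def] o_def)
  have KS: "K (s x) = s (J x)" for x
    by (simp add: K_def J_def st)
  have Jskew: "J x \<bullet> y = - (x \<bullet> J y)" for x y
    by (simp add: J_def t Nskew)
  define g where "g x = h (x, K x) (x, K x)" for x
  \<comment> \<open>The part of \<open>b\<close> that is uncorrelated with \<open>a\<close> contributes a nonnegative amount.\<close>
  have "(\<Sum>j\<in>I. h (a j, b j) (a j, b j)) \<ge> (\<Sum>j\<in>I. g (a j))"
  proof -
    define r where "r j = b j - K (a j)" for j
    have lin: "linear (\<lambda>x. (x, K x))" "linear (\<lambda>x. (0 :: 'a, x :: 'a))"
      using K by (auto simp: linear_iff)
    have "K (X y) = N y" for y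
      by (simp add: K_def st s(4)[symmetric])
    then have "(\<Sum>j\<in>I. (a j \<bullet> y) *\<^sub>R r j) = 0" for y
      by (simp add: r_def N_def X_def scaleR_diff_right sum_subtractf linear_sum[OF K] linear_scale[OF K])
    then have "(\<Sum>j\<in>I. (a j \<bullet> y) *\<^sub>R r j) = (\<Sum>j\<in>({}::'i set). (a j \<bullet> y) *\<^sub>R r j)" for y
      by simp
    from bilinear_sum_eq[OF bilinear_compose[OF h lin] this]
    have cross: "(\<Sum>j\<in>I. h (a j, K (a j)) (0, r j)) = 0"
      by simp
    have "h (a j, b j) (a j, b j) = g (a j) + 2 * h (a j, K (a j)) (0, r j) + h (0, r j) (0, r j)" for j
    proof -
      have "(a j, b j) = (a j, K (a j)) + (0, r j)" by (simp add: r_def)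
      then show ?thesis
        using hsym[of "(0, r j)" "(a j, K (a j))"]
        by (simp only: g_def bilinear_ladd[OF h] bilinear_radd[OF h])
    qed
    then have "(\<Sum>j\<in>I. h (a j, b j) (a j, b j))
        = (\<Sum>j\<in>I. g (a j)) + (\<Sum>j\<in>I. h (0, r j) (0, r j))"
      using cross by (simp add: sum.distrib sum_distrib_left[symmetric])
    then show ?thesis
      using h0 by (simp add: sum_nonneg)
  qed
  \<comment> \<open>As \<open>X = s\<^sup>2\<close>, the sum over the family is the trace of \<open>g\<close> along \<open>s\<close>, in any orthonormal basis.\<close>
  have trace: "(\<Sum>j\<in>I. g (a j)) = (\<Sum>e\<in>E. g (s e))" if "orthonormal_basis E" for E
  proof -
    have "(\<Sum>e\<in>E. (s e \<bullet> y) *\<^sub>R s e) = s (\<Sum>e\<in>E. (e \<bullet> s y) *\<^sub>R e)" for y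
      by (simp add: s(2) linear_sum[OF s(1)] linear_scale[OF s(1)])
    then have "(\<Sum>e\<in>E. (s e \<bullet> y) *\<^sub>R s e) = (\<Sum>j\<in>I. (a j \<bullet> y) *\<^sub>R a j)" for y
      by (simp add: orthonormal_basis_expansion[OF that] s(4) X_def)
    moreover have "linear (\<lambda>x. (x, K x))"
      using K by (auto simp: linear_iff)
    ultimately show ?thesis
      using bilinear_sum_eq[OF bilinear_compose[OF h, of "\<lambda>x. (x, K x)" "\<lambda>x. (x, K x)"],
          where a = a and b = a and I = I and c = s and d = s and L = E]
      by (simp add: g_def)
  qed
  \<comment> \<open>\<open>J\<close> is skew, so \<open>J\<^sup>2\<close> is self-adjoint. For \<open>e\<close> in an eigenbasis of \<open>J\<^sup>2\<close>, the operator \<open>J\<close> maps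
    \<open>e\<close> to \<open>w f\<close> and \<open>f\<close> to \<open>- w e\<close>, where \<open>f = f e\<close> and \<open>w = w e\<close>. The vectors \<open>f e\<close> form a
    second orthonormal basis. The trace is computed in both bases; each pair \<open>e\<close>, \<open>f e\<close>
    contributes a value of the frequency domain inequality.\<close>
  have JJ: "linear (\<lambda>x. J (J x))"
    using linear_compose[OF J J] by (simp add: o_def)
  have JJ_sa: "J (J x) \<bullet> y = x \<bullet> J (J y)" for x y
    by (simp add: Jskew)
  obtain E where E: "orthonormal_basis E"
    and eig: "\<And>e. e \<in> E \<Longrightarrow> J (J e) = (e \<bullet> J (J e)) *\<^sub>R e"
    using selfadjoint_eigenbasis[OF JJ JJ_sa] by blast
  define w where "w e = norm (J e)" for e
  define f where "f e = (if w e = 0 then e else J e /\<^sub>R w e)" for e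
  have w0: "J e = 0" if "w e = 0" for e
    using that by (simp add: w_def)
  have Jf: "J e = w e *\<^sub>R f e" for e
    using w0[of e] by (simp add: f_def)
  have JJe: "J (J e) = - ((w e)\<^sup>2) *\<^sub>R e" if "e \<in> E" for e
    using eig[OF that] Jskew[of e "J e"] by (simp add: w_def dot_square_norm)
  have f_inner: "f e \<bullet> f e' = (if e = e' then 1 else 0)" if "e \<in> E" "e' \<in> E" for e e'
  proof -
    have ee: "e \<bullet> e' = (if e = e' then 1 else 0)"
      using orthonormal_basis_inner[OF E that] .
    have "J e \<bullet> J e' = (if e = e' then (w e)\<^sup>2 else 0)"
      using Jskew[of e "J e'"] ee by (simp add: JJe[OF that(2)])
    moreover have "e \<bullet> J e' = 0" if "w e = 0"
      using Jskew[of e e'] w0[OF that] by simp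
    moreover have "J e \<bullet> e' = 0" if "w e' = 0"
      using Jskew[of e e'] w0[OF that] by simp
    ultimately show ?thesis
      using ee by (auto simp: f_def power2_eq_square field_simps)
  qed
  have pair: "g (s e) + g (s (f e)) \<ge> 0" if "e \<in> E" for e
  proof -
    have "J (f e) = - (w e) *\<^sub>R e"
    proof (cases "w e = 0")
      case False
      then show ?thesis
        by (simp add: f_def linear_scale[OF J] JJe[OF that] power2_eq_square)
    qed (simp add: f_def w0)
    then have 1: "K (s (f e)) = - (w e) *\<^sub>R s e"
      using linear_scale[OF s(1), of "- w e" e] by (simp add: KS)
    have 2: "K (s e) = w e *\<^sub>R s (f e)"
      unfolding KS by (subst Jf) (simp add: linear_scale[OF s(1)])
    show ?thesis
      using fdi[of "s (f e)" "w e" "s e"] unfolding g_def 1 2 by simp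
  qed
  have "2 * (\<Sum>j\<in>I. g (a j)) = (\<Sum>e\<in>E. g (s e)) + (\<Sum>e\<in>f ` E. g (s e))"
    using trace[OF E] trace[OF orthonormal_family_basis(2)[of E f, OF E f_inner]] by simp
  also have "\<dots> = (\<Sum>e\<in>E. g (s e) + g (s (f e)))"
    using orthonormal_family_basis(1)[of E f, OF E f_inner]
    by (simp add: sum.reindex sum.distrib)
  also have "\<dots> \<ge> 0"
    using pair by (rule sum_nonneg)
  finally show ?thesis
    using \<open>(\<Sum>j\<in>I. g (a j)) \<le> _\<close> by simp
qed

text \<open>The covariance is made invertible by adjoining the pairs \<open>(d i, 0)\<close>, with \<open>i\<close> in the standard
  basis and \<open>d > 0\<close> small. This leaves the skew operator unchanged.\<close>

lemma sum_form_skew_nonneg: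
  fixes h :: "'a::euclidean_space \<times> 'a \<Rightarrow> 'a \<times> 'a \<Rightarrow> real" and a b :: "'i \<Rightarrow> 'a"
  assumes "finite I"
    and h: "bilinear h" and hsym: "\<And>z w. h z w = h w z"
    and h0: "\<And>v. h (0, v) (0, v) \<ge> 0"
    and fdi: "\<And>w x y. h (x, - w *\<^sub>R y) (x, - w *\<^sub>R y) + h (y, w *\<^sub>R x) (y, w *\<^sub>R x) \<ge> 0"
    and skew: "\<And>y z. (\<Sum>j\<in>I. (a j \<bullet> y) * (b j \<bullet> z)) = - (\<Sum>j\<in>I. (a j \<bullet> z) * (b j \<bullet> y))"
  shows "(\<Sum>j\<in>I. h (a j, b j) (a j, b j)) \<ge> 0"
proof -
  define q where "q = (\<Sum>j\<in>I. h (a j, b j) (a j, b j))"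
  define p where "p = (\<Sum>i\<in>(Basis::'a set). h (i, 0) (i, 0))"
  have *: "q + d\<^sup>2 * p \<ge> 0" if "d > 0" for d
  proof -
    define a' where "a' = case_sum a (\<lambda>i. d *\<^sub>R i)"
    define b' where "b' = case_sum b (\<lambda>i::'a. 0)"
    have plus: "sum F (I <+> Basis) = (\<Sum>j\<in>I. F (Inl j)) + (\<Sum>i\<in>(Basis :: 'a set). F (Inr i))"
      for F :: "_ \<Rightarrow> real"
      using \<open>finite I\<close> by (simp add: sum.Plus)
    have "(\<Sum>k\<in>I <+> Basis. h (a' k, b' k) (a' k, b' k)) \<ge> 0"
    proof (rule sum_form_skew_nonneg_nondeg[OF h hsym h0 fdi])
      show "(\<Sum>k\<in>I <+> Basis. (a' k \<bullet> y) * (b' k \<bullet> z)) = - (\<Sum>k\<in>I <+> Basis. (a' k \<bullet> z) * (b' k \<bullet> y))" for y z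
        using skew[of y z] by (simp add: plus a'_def b'_def)
      show "(\<Sum>k\<in>I <+> Basis. (a' k \<bullet> y)\<^sup>2) > 0" if "y \<noteq> 0" for y
      proof -
        have "(\<Sum>i\<in>Basis. (d *\<^sub>R i \<bullet> y)\<^sup>2) = d\<^sup>2 * (y \<bullet> y)"
          by (subst euclidean_inner) (simp add: sum_distrib_left power2_eq_square inner_commute mult_ac)
        moreover have "d\<^sup>2 * (y \<bullet> y) > 0" using that \<open>d > 0\<close> by simp
        moreover have "(\<Sum>j\<in>I. (a j \<bullet> y)\<^sup>2) \<ge> 0" by (simp add: sum_nonneg)
        ultimately show ?thesis by (simp add: plus a'_def)
      qed
    qed
    moreover have "h (d *\<^sub>R i, 0) (d *\<^sub>R i, 0) = d\<^sup>2 * h (i, 0) (i, 0)" for i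
      using bilinear_lmul[OF h, of d "(i, 0)" "d *\<^sub>R (i, 0)"] bilinear_rmul[OF h, of "(i, 0)" d "(i, 0)"]
      by (simp add: power2_eq_square)
    ultimately show ?thesis
      by (simp add: plus a'_def b'_def q_def p_def sum_distrib_left)
  qed
  have "((\<lambda>d. q + d\<^sup>2 * p) \<longlongrightarrow> q + 0\<^sup>2 * p) (at_right 0)"
    by (intro tendsto_intros)
  then have "q + 0\<^sup>2 * p \<ge> 0"
  proof (rule tendsto_lowerbound)
    show "\<forall>\<^sub>F d in at_right 0. 0 \<le> q + d\<^sup>2 * p"
      using * by (auto intro: eventually_at_right_less[THEN eventually_mono])
  qed simp
  then show ?thesis by (simp add: q_def)
qed

section \<open>The Kalman-Yakubovich-Popov lemma\<close>

lemma inner_sym_outer: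
  fixes x v y z :: "real^'n"
  shows "y \<bullet> ((\<chi> i j. x $ i * v $ j + v $ i * x $ j) *v z) = (x \<bullet> y) * (v \<bullet> z) + (v \<bullet> y) * (x \<bullet> z)"
proof -
  have "(\<chi> i j. x $ i * v $ j + v $ i * x $ j) *v z = (v \<bullet> z) *\<^sub>R x + (x \<bullet> z) *\<^sub>R v"
    by (simp add: vec_eq_iff matrix_vector_mult_def inner_vec_def algebra_simps sum.distrib sum_distrib_left)
  then show ?thesis by (simp add: inner_add inner_commute mult.commute)
qed

lemma matrix_inner_sym_outer:
  fixes G :: "real^'n^'n"
  shows "G \<bullet> (\<chi> i j. x $ i * v $ j + v $ i * x $ j) = v \<bullet> ((G + transpose G) *v x)"
proof -
  have "G \<bullet> (\<chi> i j. x $ i * v $ j + v $ i * x $ j) = x \<bullet> (G *v v) + v \<bullet> (G *v x)"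
    by (simp add: inner_vec_def matrix_vector_mult_def sum_distrib_left sum.distrib algebra_simps)
  also have "x \<bullet> (G *v v) = v \<bullet> (transpose G *v x)"
    by (simp add: dot_lmul_matrix[symmetric] inner_commute)
  finally show ?thesis
    by (simp add: matrix_vector_mult_add_rdistrib inner_add_right)
qed

text \<open>Let \<open>q(x, v)\<close> be the form \<open>h\<close> with the perturbation \<open>d (|x|\<^sup>2 + |v|\<^sup>2)\<close> added.
  The points \<open>(x v\<^sup>T + v x\<^sup>T, q(x, v))\<close> with \<open>(x, v)\<close> on the unit sphere have a compact convex hull
  which does not meet \<open>{0} \<times> (-\<infinity>, 0]\<close>. A separating hyperplane has a normal \<open>(G, c)\<close> with \<open>c > 0\<close>, and the
  symmetric part of \<open>G / c\<close> is the required matrix.\<close>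

lemma kyp_perturbed:
  fixes h :: "(real^'n) \<times> (real^'n) \<Rightarrow> (real^'n) \<times> (real^'n) \<Rightarrow> real"
  assumes h: "bilinear h" and hsym: "\<And>z w. h z w = h w z"
    and h0: "\<And>v. h (0, v) (0, v) \<ge> 0"
    and fdi: "\<And>w x y. h (x, - w *\<^sub>R y) (x, - w *\<^sub>R y) + h (y, w *\<^sub>R x) (y, w *\<^sub>R x) \<ge> 0"
    and d: "d > 0"
  shows "\<exists>P. transpose P = P \<and> (\<forall>x v. h (x, v) (x, v) + d * (x \<bullet> x + v \<bullet> v) + 2 * (v \<bullet> (P *v x)) \<ge> 0)"
proof -
  define out :: "(real^'n) \<times> (real^'n) \<Rightarrow> real^'n^'n"
    where "out z = (\<chi> i j. fst z $ i * snd z $ j + snd z $ i * fst z $ j)" for z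
  define q where "q z = h z z + d * (z \<bullet> z)" for z
  define \<phi> where "\<phi> z = (out z, q z)" for z
  define D where "D = \<phi> ` sphere 0 1"
  interpret h: bounded_bilinear h
    using h by (simp add: bilinear_conv_bounded_bilinear)
  have "continuous_on (sphere 0 1) \<phi>"
    unfolding \<phi>_def out_def q_def
    by (intro continuous_intros h.continuous_on continuous_on_vec_lambda)
  then have D: "compact D"
    unfolding D_def by (rule compact_continuous_image) simp
  define T where "T = {0 :: real^'n^'n} \<times> {..0 :: real}"
  have T: "convex T" "closed T"
    by (auto simp: T_def intro: convex_Times closed_Times)
  have disj: "T \<inter> convex hull D = {}"
  proof -
    have False if "p \<in> T" "p \<in> convex hull D" for p
    proof -
      from \<open>p \<in> convex hull D\<close> obtain S u where S: "finite S" "S \<subseteq> D" "\<forall>p\<in>S. 0 \<le> u p" "sum u S = 1"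
        and p: "(\<Sum>s\<in>S. u s *\<^sub>R s) = p"
        unfolding convex_hull_explicit by blast
      have "\<forall>s\<in>S. \<exists>z. z \<in> sphere 0 1 \<and> s = \<phi> z"
        using S(2) unfolding D_def by blast
      then obtain z where z: "\<And>s. s \<in> S \<Longrightarrow> norm (z s) = 1" "\<And>s. s \<in> S \<Longrightarrow> \<phi> (z s) = s"
        unfolding bchoice_iff by (metis mem_sphere_0)
      define a where "a s = sqrt (u s) *\<^sub>R fst (z s)" for s
      define b where "b s = sqrt (u s) *\<^sub>R snd (z s)" for s
      have "(\<Sum>s\<in>S. u s *\<^sub>R \<phi> (z s)) = p"
        using p z(2) by simp
      then have fstp: "(\<Sum>s\<in>S. u s *\<^sub>R out (z s)) = 0" and sndp: "(\<Sum>s\<in>S. u s * q (z s)) \<le> 0"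
        using \<open>p \<in> T\<close> by (auto simp: T_def \<phi>_def prod_eq_iff fst_sum snd_sum)
      have "(\<Sum>s\<in>S. h (a s, b s) (a s, b s)) \<ge> 0"
      proof (rule sum_form_skew_nonneg[OF S(1) h hsym h0 fdi])
        fix y w :: "real^'n"
        have out: "y \<bullet> (out t *v w) = (fst t \<bullet> y) * (snd t \<bullet> w) + (snd t \<bullet> y) * (fst t \<bullet> w)" for t
          by (simp add: out_def inner_sym_outer)
        have "linear (\<lambda>M :: real^'n^'n. y \<bullet> (M *v w))"
          by (simp add: linear_iff matrix_vector_mult_add_rdistrib inner_add_right scaleR_matrix_vector_assoc[symmetric])
        from linear_sum[OF this, of "\<lambda>s. u s *\<^sub>R out (z s)" S]
        have "(\<Sum>s\<in>S. u s * ((fst (z s) \<bullet> y) * (snd (z s) \<bullet> w) + (snd (z s) \<bullet> y) * (fst (z s) \<bullet> w))) = 0"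
          by (simp add: fstp out scaleR_matrix_vector_assoc[symmetric])
        also have "(\<Sum>s\<in>S. u s * ((fst (z s) \<bullet> y) * (snd (z s) \<bullet> w) + (snd (z s) \<bullet> y) * (fst (z s) \<bullet> w)))
          = (\<Sum>s\<in>S. (a s \<bullet> y) * (b s \<bullet> w) + (a s \<bullet> w) * (b s \<bullet> y))"
        proof (rule sum.cong)
          fix s assume "s \<in> S"
          then have "sqrt (u s) * sqrt (u s) = u s" using S(3) by simp
          then have "(a s \<bullet> y) * (b s \<bullet> w) + (a s \<bullet> w) * (b s \<bullet> y)
            = u s * ((fst (z s) \<bullet> y) * (snd (z s) \<bullet> w) + (fst (z s) \<bullet> w) * (snd (z s) \<bullet> y))"
            unfolding a_def b_def inner_scaleR_left by (metis (no_types, opaque_lifting) distrib_left mult.assoc mult.left_commute)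
          then show "u s * ((fst (z s) \<bullet> y) * (snd (z s) \<bullet> w) + (snd (z s) \<bullet> y) * (fst (z s) \<bullet> w))
            = (a s \<bullet> y) * (b s \<bullet> w) + (a s \<bullet> w) * (b s \<bullet> y)" by (simp add: mult.commute)
        qed simp
        finally show "(\<Sum>s\<in>S. (a s \<bullet> y) * (b s \<bullet> w)) = - (\<Sum>s\<in>S. (a s \<bullet> w) * (b s \<bullet> y))"
          by (simp add: sum.distrib)
      qed
      also have "(\<Sum>s\<in>S. h (a s, b s) (a s, b s)) = (\<Sum>s\<in>S. u s * h (z s) (z s))"
      proof (rule sum.cong)
        fix s assume "s \<in> S"
        then have "sqrt (u s) * sqrt (u s) = u s" using S(3) by simp
        moreover have "(a s, b s) = sqrt (u s) *\<^sub>R z s"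
          by (simp add: a_def b_def prod_eq_iff)
        ultimately show "h (a s, b s) (a s, b s) = u s * h (z s) (z s)"
          by (simp add: h.scaleR_left h.scaleR_right)
      qed simp
      finally have "(\<Sum>s\<in>S. u s * q (z s)) \<ge> d"
        using S(4) z(1) by (simp add: q_def dot_square_norm algebra_simps sum.distrib sum_distrib_left[symmetric])
      then show False using sndp d by simp
    qed
    then show ?thesis by blast
  qed
  have axis1: "(axis undefined 1 :: real^'n, 0 :: real^'n) \<in> sphere 0 1"
    by (simp add: norm_Pair)
  then have "convex hull D \<noteq> {}"
    by (auto simp: D_def)
  with separating_hyperplane_closed_compact[OF T convex_convex_hull compact_convex_hull[OF D] _ disj]
  obtain Gc b where sepT: "\<And>p. p \<in> T \<Longrightarrow> Gc \<bullet> p < b" and sepD: "\<And>p. p \<in> D \<Longrightarrow> Gc \<bullet> p > b"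
    by (metis hull_inc)
  obtain G c where Gc: "Gc = (G, c)" by (cases Gc)
  have "b > 0"
    using sepT[of "(0, 0)"] by (simp add: T_def Gc)
  have "c \<ge> 0"
  proof (rule ccontr)
    assume "\<not> c \<ge> 0"
    then have "(0, b / c) \<in> T" using \<open>b > 0\<close> by (simp add: T_def divide_le_0_iff)
    from sepT[OF this] \<open>\<not> c \<ge> 0\<close> show False by (simp add: Gc)
  qed
  have sep: "v \<bullet> ((G + transpose G) *v x) + c * q (x, v) > 0" if "(x, v) \<in> sphere 0 1" for x v
  proof -
    have "\<phi> (x, v) \<in> D" using that by (simp add: D_def)
    from sepD[OF this] \<open>b > 0\<close> show ?thesis
      by (simp add: Gc \<phi>_def out_def matrix_inner_sym_outer)
  qed
  have "c \<noteq> 0"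
    using sep[OF axis1] by auto
  with \<open>c \<ge> 0\<close> have "c > 0" by simp
  define P where "P = (1 / (2 * c)) *\<^sub>R (G + transpose G)"
  define Q where "Q z = q z + 2 * (snd z \<bullet> (P *v fst z))" for z
  have "transpose P = P"
    by (simp add: P_def transpose_def vec_eq_iff)
  moreover have "Q z \<ge> 0" for z
  proof (cases "z = 0")
    case True
    then show ?thesis by (simp add: Q_def q_def h.zero_left)
  next
    case False
    define u where "u = z /\<^sub>R norm z"
    have "u \<in> sphere 0 1" using False by (simp add: u_def)
    then have "c * Q u > 0"
      using sep[of "fst u" "snd u"] \<open>c > 0\<close>
      by (simp add: Q_def P_def scaleR_matrix_vector_assoc[symmetric] distrib_left)
    then have "Q u > 0" using \<open>c > 0\<close> by (simp add: zero_less_mult_iff)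
    have "z = norm z *\<^sub>R u" using False by (simp add: u_def)
    then have "Q z = Q (norm z *\<^sub>R u)" by simp
    also have "\<dots> = (norm z)\<^sup>2 * Q u"
      by (simp add: Q_def q_def h.scaleR_left h.scaleR_right matrix_vector_mult_scaleR power2_eq_square algebra_simps)
    finally show ?thesis using \<open>Q u > 0\<close> by simp
  qed
  ultimately show ?thesis
    by (intro exI[of _ P]) (force simp: Q_def q_def)
qed

text \<open>With the velocity \<open>v\<close> unconstrained, the solutions for a perturbation \<open>d\<close> are bounded, so they have
  a limit point as \<open>d\<close> tends to \<open>0\<close>.\<close>

lemma kyp_lemma:
  fixes h :: "(real^'n) \<times> (real^'n) \<Rightarrow> (real^'n) \<times> (real^'n) \<Rightarrow> real"
  assumes h: "bilinear h" and hsym: "\<And>z w. h z w = h w z"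
    and h0: "\<And>v. h (0, v) (0, v) \<ge> 0"
    and fdi: "\<And>w x y. h (x, - w *\<^sub>R y) (x, - w *\<^sub>R y) + h (y, w *\<^sub>R x) (y, w *\<^sub>R x) \<ge> 0"
  obtains P where "transpose P = P" "\<And>x v. h (x, v) (x, v) + 2 * (v \<bullet> (P *v x)) \<ge> 0"
proof -
  define F where "F n = {P. transpose P = P \<and> (\<forall>x v. h (x, v) (x, v) + (1 / real (Suc n)) * (x \<bullet> x + v \<bullet> v)
      + 2 * (v \<bullet> (P *v x)) \<ge> 0)}" for n
  have lin: "linear (\<lambda>M :: real^'n^'n. y \<bullet> (M *v w))" for y w
    by (simp add: linear_iff matrix_vector_mult_add_rdistrib inner_add_right scaleR_matrix_vector_assoc[symmetric])
  have cont: "continuous_on UNIV (\<lambda>M :: real^'n^'n. y \<bullet> (M *v w))" for y w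
    using lin by (simp add: linear_continuous_on linear_conv_bounded_linear)
  have "closed (F n)" for n
  proof -
    have "linear (transpose :: real^'n^'n \<Rightarrow> _)"
      by (simp add: linear_iff transpose_def vec_eq_iff)
    then have "continuous_on UNIV (transpose :: real^'n^'n \<Rightarrow> _)"
      by (simp add: linear_continuous_on linear_conv_bounded_linear)
    then show ?thesis
      unfolding F_def
      by (intro closed_Collect_conj closed_Collect_all closed_Collect_eq closed_Collect_le continuous_intros cont)
  qed
  moreover have "bounded (F n)" for n
  proof -
    \<comment> \<open>The inequalities at \<open>v = e\<^sub>i\<close> and \<open>v = - e\<^sub>i\<close>, with \<open>x = e\<^sub>j\<close>, bound the entry \<open>P\<^sub>i\<^sub>j\<close> from both sides.\<close>
    define B where "B i j = \<bar>h (axis j 1, axis i 1) (axis j 1, axis i 1)\<bar> + \<bar>h (axis j 1, - axis i 1) (axis j 1, - axis i 1)\<bar> + 2"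
      for i j :: 'n
    have "norm P \<le> (\<Sum>i\<in>UNIV. \<Sum>j\<in>UNIV. B i j)" if "P \<in> F n" for P
    proof -
      have "\<bar>P $ i $ j\<bar> \<le> B i j" for i j
      proof -
        have entry: "axis i 1 \<bullet> (P *v axis j 1) = P $ i $ j"
          by (simp add: inner_axis' matrix_vector_mul_component inner_axis)
        have "h (axis j 1, v) (axis j 1, v) + (1 / real (Suc n)) * (axis j 1 \<bullet> (axis j 1 :: real^'n) + v \<bullet> v) + 2 * (v \<bullet> (P *v axis j 1)) \<ge> 0" for v
          using that unfolding F_def by blast
        from this[of "axis i 1"] this[of "- axis i 1"]
        have "\<bar>2 * P $ i $ j\<bar> \<le> \<bar>h (axis j 1, axis i 1) (axis j 1, axis i 1)\<bar> + \<bar>h (axis j 1, - axis i 1) (axis j 1, - axis i 1)\<bar> + 2 / real (Suc n)"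
          by (simp add: entry inner_axis_axis)
        also have "2 / real (Suc n) \<le> 2" by (simp add: divide_le_eq)
        finally show ?thesis by (simp add: B_def)
      qed
      then have "norm (P $ i) \<le> (\<Sum>j\<in>UNIV. B i j)" for i
        using norm_le_l1_cart[of "P $ i"] by (meson order_trans sum_mono)
      moreover have "norm P \<le> (\<Sum>i\<in>UNIV. norm (P $ i))"
        unfolding norm_vec_def by (rule L2_set_le_sum) simp
      ultimately show ?thesis by (meson order_trans sum_mono)
    qed
    then show ?thesis by (auto simp: bounded_iff)
  qed
  ultimately have "compact (F n)" for n
    by (simp add: compact_eq_bounded_closed)
  moreover have "F n \<noteq> {}" for n
    using kyp_perturbed[OF h hsym h0 fdi, of "1 / real (Suc n)"] by (auto simp: F_def)
  moreover have "F n \<subseteq> F m" if "m \<le> n" for m n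
  proof -
    have "1 / real (Suc n) \<le> 1 / real (Suc m)" using that by (simp add: frac_le)
    then have "(1 / real (Suc n)) * (x \<bullet> x + v \<bullet> v) \<le> (1 / real (Suc m)) * (x \<bullet> x + v \<bullet> v)" for x v :: "real^'n"
      by (rule mult_right_mono) simp
    then show ?thesis unfolding F_def by (blast intro: order_trans add_mono order_refl)
  qed
  ultimately have "\<Inter> (range F) \<noteq> {}"
    by (rule compact_nest)
  then obtain P where P: "\<And>n. P \<in> F n" by auto
  show thesis
  proof (rule that)
    show "transpose P = P" using P by (simp add: F_def)
    show "h (x, v) (x, v) + 2 * (v \<bullet> (P *v x)) \<ge> 0" for x v
    proof (rule tendsto_lowerbound)
      have "(\<lambda>n. 1 / real (Suc n)) \<longlonglongrightarrow> 0"
        using LIMSEQ_inverse_real_of_nat by (simp add: inverse_eq_divide)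
      then have "(\<lambda>n. h (x, v) (x, v) + (1 / real (Suc n)) * (x \<bullet> x + v \<bullet> v) + 2 * (v \<bullet> (P *v x)))
        \<longlonglongrightarrow> h (x, v) (x, v) + 0 * (x \<bullet> x + v \<bullet> v) + 2 * (v \<bullet> (P *v x))"
        by (intro tendsto_intros)
      then show "(\<lambda>n. h (x, v) (x, v) + (1 / real (Suc n)) * (x \<bullet> x + v \<bullet> v) + 2 * (v \<bullet> (P *v x)))
        \<longlonglongrightarrow> h (x, v) (x, v) + 2 * (v \<bullet> (P *v x))" by simp
      show "\<forall>\<^sub>F n in sequentially. 0 \<le> h (x, v) (x, v) + (1 / real (Suc n)) * (x \<bullet> x + v \<bullet> v) + 2 * (v \<bullet> (P *v x))"
        using P by (simp add: F_def)
    qed simp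
  qed
qed

section \<open>Products of shifts and Lyapunov forms of stable matrices\<close>

lemma of_real_vector_scalar_mult: "complex_of_real r *s y = r *\<^sub>R (y :: complex^'n)"
  by (simp add: vec_eq_iff scaleR_conv_of_real[of _ "_ :: complex"])

text \<open>The vector \<open>(M - l\<^sub>k) \<cdots> (M - l\<^sub>1) x\<close> for a list \<open>l\<^sub>1, \<dots>, l\<^sub>k\<close>.\<close>

fun shift_prod :: "complex^'n^'n \<Rightarrow> complex list \<Rightarrow> complex^'n \<Rightarrow> complex^'n" where
  "shift_prod M [] x = x"
| "shift_prod M (l # ls) x = shift_prod M ls (M *v x - l *s x)"

lemma shift_prod_shift:
  "shift_prod M ls (M *v x - l *s x) = M *v shift_prod M ls x - l *s shift_prod M ls x"
proof (induction ls arbitrary: x)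
  case (Cons k ls)
  have "M *v (M *v x - l *s x) - k *s (M *v x - l *s x)
      = M *v (M *v x - k *s x) - l *s (M *v x - k *s x)"
    by (simp add: matrix_vector_mult_diff_distrib vector_scalar_commute vector_sub_rdistrib
        vector_ssub_ldistrib vec.scale_left_commute)
  with Cons.IH[of "M *v x - k *s x"] show ?case by simp
qed simp

lemma shift_prod_eigenvector:
  "M *v x = k *s x \<Longrightarrow> shift_prod M ls x = (\<Prod>l\<leftarrow>ls. k - l) *s x"
proof (induction ls arbitrary: x)
  case (Cons l ls)
  have "M *v x - l *s x = (k - l) *s x"
    by (simp add: Cons.prems vector_sub_rdistrib)
  moreover have "M *v ((k - l) *s x) = k *s ((k - l) *s x)"
    by (simp only: Cons.prems vector_scalar_commute vector_smult_assoc mult.commute)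
  ultimately show ?case using Cons.IH[of "(k - l) *s x"] by (simp add: mult.commute left_diff_distrib)
qed simp

text \<open>The vector \<open>p(M) x\<close> for a polynomial \<open>p\<close>.\<close>

definition poly_action :: "complex^'n^'n \<Rightarrow> complex poly \<Rightarrow> complex^'n \<Rightarrow> complex^'n" where
  "poly_action M p x = (\<Sum>i\<le>degree p. coeff p i *s (((*v) M ^^ i) x))"

lemma poly_action_altdef:
  assumes "degree p \<le> N"
  shows "poly_action M p x = (\<Sum>i\<le>N. coeff p i *s (((*v) M ^^ i) x))"
  unfolding poly_action_def
  by (rule sum.mono_neutral_left) (use assms in \<open>auto simp: coeff_eq_0\<close>)

lemma poly_action_linear_factor:
  "poly_action M ([:-l, 1:] * p) x = poly_action M p (M *v x - l *s x)"
proof -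
  have lin: "((*v) M ^^ i) (x + y) = ((*v) M ^^ i) x + ((*v) M ^^ i) y"
    "((*v) M ^^ i) (c *s x) = c *s ((*v) M ^^ i) x" for i x y c
    by (induction i) (simp_all add: matrix_vector_right_distrib vector_scalar_commute)
  have sub: "((*v) M ^^ i) (M *v x - l *s x) = ((*v) M ^^ Suc i) x - l *s ((*v) M ^^ i) x" for i
    using lin(1)[of i "M *v x" "(-l) *s x"] lin(2)[of i "-l" x] funpow_swap1[of "(*v) M" i x]
    by simp
  let ?N = "degree p"
  have c: "coeff ([:-l, 1:] * p) i = coeff (pCons 0 p) i - l * coeff p i" for i
    by simp
  have "degree ([:-l, 1:] * p) \<le> Suc ?N"
    using degree_mult_le[of "[:-l, 1:]" p] by simp
  then have "poly_action M ([:-l, 1:] * p) x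
      = (\<Sum>i\<le>Suc ?N. coeff ([:-l, 1:] * p) i *s (((*v) M ^^ i) x))"
    by (rule poly_action_altdef)
  also have "(\<Sum>i\<le>Suc ?N. coeff ([:-l, 1:] * p) i *s (((*v) M ^^ i) x))
      = (\<Sum>i\<le>Suc ?N. coeff (pCons 0 p) i *s (((*v) M ^^ i) x))
      - (\<Sum>i\<le>Suc ?N. (l * coeff p i) *s (((*v) M ^^ i) x))"
    by (simp only: c vector_sub_rdistrib sum_subtractf)
  also have "(\<Sum>i\<le>Suc ?N. (l * coeff p i) *s (((*v) M ^^ i) x))
      = (\<Sum>i\<le>?N. (l * coeff p i) *s (((*v) M ^^ i) x))"
    by (simp add: coeff_eq_0)
  also have "(\<Sum>i\<le>Suc ?N. coeff (pCons 0 p) i *s (((*v) M ^^ i) x))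
      = (\<Sum>i\<le>?N. coeff p i *s (((*v) M ^^ Suc i) x))"
    by (subst sum.atMost_Suc_shift) simp
  also have "\<dots> - (\<Sum>i\<le>?N. (l * coeff p i) *s (((*v) M ^^ i) x))
      = poly_action M p (M *v x - l *s x)"
    unfolding poly_action_def sub
    by (simp only: sum_subtractf vector_ssub_ldistrib vector_smult_assoc mult.commute)
  finally show ?thesis .
qed

lemma poly_action_smult: "poly_action M (smult c p) x = c *s poly_action M p x"
  by (cases "c = 0") (simp_all add: poly_action_def vec.scale_sum_right)

lemma poly_action_prod: "poly_action M (\<Prod>l\<leftarrow>ls. [:-l, 1:]) x = shift_prod M ls x"
proof (induction ls arbitrary: x)
  case Nil
  show ?case by (simp add: poly_action_def)
next
  case (Cons l ls)
  show ?case
    using poly_action_linear_factor[of M l "\<Prod>l\<leftarrow>ls. [:-l, 1:]" x] Cons.IH by simp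
qed

lemma ex_annihilating_poly:
  fixes M :: "complex^'n^'n"
  obtains p where "p \<noteq> 0" "\<And>x. poly_action M p x = 0"
proof -
  define m where "m i = (((**) M) ^^ i) (mat 1)" for i
  have m: "m i *v x = ((*v) M ^^ i) x" for i x
    unfolding m_def by (induction i) (simp_all add: matrix_vector_mul_assoc[symmetric])
  let ?N = "DIM(complex^'n^'n)"
  \<comment> \<open>The powers of \<open>M\<close> live in a space of finite real dimension; they may fail to be dependent as a
    set when two of them coincide.\<close>
  have "\<exists>c :: nat \<Rightarrow> real. (\<exists>i\<le>?N. c i \<noteq> 0) \<and> (\<Sum>i\<le>?N. c i *\<^sub>R m i) = 0"
  proof (cases "inj_on m {..?N}")
    case True
    then have "dependent (m ` {..?N})"
      by (intro dependent_biggerset) (simp add: card_image)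
    then obtain u where u: "\<exists>v\<in>m ` {..?N}. u v \<noteq> 0" "(\<Sum>v\<in>m ` {..?N}. u v *\<^sub>R v) = 0"
      by (auto simp: dependent_finite)
    then show ?thesis
      using True by (intro exI[of _ "u \<circ> m"]) (auto simp: sum.reindex)
  next
    case False
    then obtain i j where ij: "i \<le> ?N" "j \<le> ?N" "i \<noteq> j" "m i = m j"
      by (auto simp: inj_on_def)
    define c where "c k = (if k = i then 1 else 0) - (if k = j then 1 else (0::real))" for k
    have "(\<Sum>k\<le>?N. c k *\<^sub>R m k) = (\<Sum>k\<le>?N. if k = i then m k else 0) - (\<Sum>k\<le>?N. if k = j then m k else 0)"
      unfolding sum_subtractf[symmetric] c_def by (rule sum.cong) (auto simp: scaleR_diff_left)
    also have "\<dots> = 0" using ij by simp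
    finally show ?thesis using ij by (intro exI[of _ c]) (auto simp: c_def intro!: exI[of _ i])
  qed
  then obtain c i where c: "i \<le> ?N" "c i \<noteq> 0" "(\<Sum>i\<le>?N. c i *\<^sub>R m i) = 0" by blast
  define p where "p = (\<Sum>k\<le>?N. monom (complex_of_real (c k)) k)"
  have coeff: "coeff p k = (if k \<le> ?N then complex_of_real (c k) else 0)" for k
    by (simp add: p_def coeff_sum)
  have "degree p \<le> ?N"
    by (rule degree_le) (simp add: coeff)
  show thesis
  proof (rule that)
    show "p \<noteq> 0"
      using coeff[of i] c by auto
    show "poly_action M p x = 0" for x
    proof -
      have "poly_action M p x = (\<Sum>k\<le>?N. c k *\<^sub>R (m k *v x))"
        unfolding poly_action_altdef[OF \<open>degree p \<le> ?N\<close>]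
        by (rule sum.cong) (simp_all add: coeff m of_real_vector_scalar_mult)
      also have "\<dots> = (\<Sum>k\<le>?N. c k *\<^sub>R m k) *v x"
      proof -
        have "linear (\<lambda>M :: complex^'n^'n. M *v x)"
          by (simp add: linear_iff vec_eq_iff matrix_vector_mult_def scaleR_sum_right sum.distrib distrib_right)
        from linear_sum[OF this, of "\<lambda>k. c k *\<^sub>R m k" "{..?N}"] linear_scale[OF this] show ?thesis by simp
      qed
      finally show ?thesis unfolding c(3) by simp
    qed
  qed
qed

lemma ex_annihilating_shifts:
  fixes M :: "complex^'n^'n"
  obtains ls where "\<And>x. shift_prod M ls x = 0"
proof -
  obtain p where p: "p \<noteq> 0" "\<And>x. poly_action M p x = 0"
    using ex_annihilating_poly[of M] by blast
  obtain A where "p = smult (lead_coeff p) (\<Prod>l\<in>#A. [:-l, 1:])"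
    using alg_closed_imp_factorization[OF p(1)] by blast
  moreover obtain ls where "mset ls = A" using ex_mset by blast
  ultimately have "p = smult (lead_coeff p) (\<Prod>l\<leftarrow>ls. [:-l, 1:])"
    by (metis mset_map prod_mset_prod_list)
  then have "lead_coeff p *s shift_prod M ls x = 0" for x
    using p(2)[of x] by (metis poly_action_smult poly_action_prod)
  then show thesis using that p(1) by auto
qed

text \<open>Finiteness gives the maxima in the spectral abscissa and in the largest singular value their
  meaning.\<close>

lemma finite_eigenvalues: "finite (eigenvalues (M :: complex^'n^'n))"
proof -
  obtain ls where ls: "\<And>x. shift_prod M ls x = 0"
    using ex_annihilating_shifts[of M] by blast
  have "eigenvalues M \<subseteq> set ls"
  proof
    fix k assume "k \<in> eigenvalues M"
    then obtain x where "x \<noteq> 0" "M *v x = k *s x" by (auto simp: eigenvalues_def)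
    with shift_prod_eigenvector[of M x k ls] ls[of x] have "(\<Prod>l\<leftarrow>ls. k - l) = 0" by auto
    then show "k \<in> set ls" by (auto simp: prod_list_zero_iff)
  qed
  then show ?thesis by (rule finite_subset) simp
qed

text \<open>Away from the eigenvalues \<open>M - l\<close> is injective, so such factors can be cancelled.\<close>

lemma shift_prod_drop_noneigenvalues:
  "shift_prod M ls x = 0 \<Longrightarrow> shift_prod M (filter (\<lambda>l. l \<in> eigenvalues M) ls) x = 0"
proof (induction ls arbitrary: x)
  case (Cons l ls)
  show ?case
  proof (cases "l \<in> eigenvalues M")
    case True
    with Cons show ?thesis by simp
  next
    case False
    have "M *v shift_prod M ls x = l *s shift_prod M ls x"
      using Cons.prems by (simp add: shift_prod_shift)
    with False have "shift_prod M ls x = 0" by (auto simp: eigenvalues_def)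
    with Cons.IH False show ?thesis by simp
  qed
qed simp

text \<open>The form \<open>\<Sum>\<^sub>i \<mu>\<^sup>-\<^sup>2\<^sup>i x\<^sub>i \<bullet> y\<^sub>i\<close>, where \<open>x\<^sub>i = (M - l\<^sub>i) \<cdots> (M - l\<^sub>1) x\<close> and \<open>i\<close> runs
  from \<open>0\<close> to one less than the length of the list, with the real inner product of complex vectors.\<close>

fun lyapunov_form :: "complex^'n^'n \<Rightarrow> real \<Rightarrow> complex list \<Rightarrow> complex^'n \<Rightarrow> complex^'n \<Rightarrow> real" where
  "lyapunov_form M \<mu> [] x y = 0"
| "lyapunov_form M \<mu> (l # ls) x y
     = x \<bullet> y + lyapunov_form M \<mu> ls (M *v x - l *s x) (M *v y - l *s y) / \<mu>\<^sup>2"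

lemma linear_complex_shift: "linear (\<lambda>x. M *v x - l *s (x :: complex^'n))"
  unfolding linear_iff of_real_vector_scalar_mult[symmetric]
  by (simp add: matrix_vector_right_distrib vector_scalar_commute vec.scale_left_commute
      vector_add_ldistrib vec.scale_right_diff_distrib del: vector_smult_assoc)

lemma lyapunov_form_commute: "lyapunov_form M \<mu> ls x y = lyapunov_form M \<mu> ls y x"
  by (induction ls arbitrary: x y) (simp_all add: inner_commute)

lemma lyapunov_form_linear: "linear (lyapunov_form M \<mu> ls x)"
proof (induction ls arbitrary: x)
  case (Cons l ls)
  have "linear (\<lambda>y. lyapunov_form M \<mu> ls (M *v x - l *s x) (M *v y - l *s y))"
    using linear_compose[OF linear_complex_shift[of M l] Cons.IH[of "M *v x - l *s x"]]
    by (simp add: o_def)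
  then show ?case
    by (simp add: linear_iff inner_add_right add_divide_distrib distrib_left)
qed (simp add: linear_iff)

lemma lyapunov_form_bilinear: "bilinear (lyapunov_form M \<mu> ls)"
proof -
  have "(\<lambda>x. lyapunov_form M \<mu> ls x y) = lyapunov_form M \<mu> ls y" for y
    using lyapunov_form_commute by blast
  then show ?thesis by (simp add: bilinear_def lyapunov_form_linear)
qed

lemma lyapunov_form_nonneg: "lyapunov_form M \<mu> ls x x \<ge> 0"
  by (induction ls arbitrary: x) simp_all

text \<open>Along \<open>x' = M x\<close> the vectors of the chain satisfy \<open>x\<^sub>i' = l\<^sub>i\<^sub>+\<^sub>1 x\<^sub>i + x\<^sub>i\<^sub>+\<^sub>1\<close>. The weights
  \<open>\<mu>\<^sup>-\<^sup>2\<^sup>i\<close> let the decay of \<open>x\<^sub>i\<^sub>+\<^sub>1\<close> absorb the coupling term, and the chain ends in \<open>0\<close>.\<close>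

lemma lyapunov_form_decrease:
  assumes "\<mu> > 0" and "\<And>l. l \<in> set ls \<Longrightarrow> Re l \<le> - \<mu>" and "shift_prod M ls x = 0"
  shows "lyapunov_form M \<mu> ls x (M *v x) \<le> - (\<mu> / 2) * (norm x)\<^sup>2"
  using assms(2,3)
proof (induction ls arbitrary: x)
  case (Cons l ls)
  define x' where "x' = M *v x - l *s x"
  have "x \<bullet> (l *s x) = Re l * (norm x)\<^sup>2"
    by (simp add: power2_norm_eq_inner inner_vec_def inner_complex_def sum_distrib_left algebra_simps)
  moreover have "Re l * (norm x)\<^sup>2 \<le> - \<mu> * (norm x)\<^sup>2"
    using Cons.prems(1)[of l] by (intro mult_right_mono) auto
  moreover have "x \<bullet> (M *v x) = x \<bullet> (l *s x) + x \<bullet> x'"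
    by (simp add: x'_def inner_diff_right)
  moreover have "x \<bullet> x' \<le> (\<mu> / 2) * (norm x)\<^sup>2 + (norm x')\<^sup>2 / (2 * \<mu>)"
  proof -
    have "0 \<le> (\<mu> * norm x - norm x')\<^sup>2 / (2 * \<mu>)"
      using assms(1) by simp
    also have "\<dots> = (\<mu> / 2) * (norm x)\<^sup>2 + (norm x')\<^sup>2 / (2 * \<mu>) - norm x * norm x'"
      using assms(1) by (simp add: power2_eq_square field_simps)
    finally show ?thesis using norm_cauchy_schwarz[of x x'] by linarith
  qed
  moreover have "lyapunov_form M \<mu> ls x' (M *v x') / \<mu>\<^sup>2 \<le> - ((norm x')\<^sup>2 / (2 * \<mu>))"
  proof -
    have "lyapunov_form M \<mu> ls x' (M *v x') \<le> - (\<mu> / 2) * (norm x')\<^sup>2"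
      using Cons by (simp add: x'_def)
    then have "lyapunov_form M \<mu> ls x' (M *v x') / \<mu>\<^sup>2 \<le> (- (\<mu> / 2) * (norm x')\<^sup>2) / \<mu>\<^sup>2"
      by (rule divide_right_mono) simp
    also have "\<dots> = - ((norm x')\<^sup>2 / (2 * \<mu>))"
      using assms(1) by (simp add: power2_eq_square field_simps)
    finally show ?thesis .
  qed
  moreover have "M *v (M *v x) - l *s (M *v x) = M *v x'"
    by (simp add: x'_def matrix_vector_mult_diff_distrib vector_scalar_commute)
  ultimately show ?case by (simp add: x'_def[symmetric])
qed simp

text \<open>The inclusion of the real vectors into the complex vectors.\<close>

definition cvec :: "real^'n \<Rightarrow> complex^'n" where
  "cvec x = (\<chi> i. complex_of_real (x $ i))"

lemma linear_cvec: "linear cvec"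
  by (simp add: linear_iff cvec_def vec_eq_iff) (simp add: scaleR_conv_of_real)

lemma cvec_eq_0_iff [simp]: "cvec x = 0 \<longleftrightarrow> x = 0"
  by (simp add: cvec_def vec_eq_iff)

lemma cmatrix_cvec: "cmatrix M *v cvec x = cvec (M *v x)"
  by (simp add: cmatrix_def map_matrix_def cvec_def vec_eq_iff matrix_vector_mult_def)

lemma ex_lyapunov_form:
  fixes M :: "real^'n^'n"
  assumes stable: "\<And>l. l \<in> eigenvalues (cmatrix M) \<Longrightarrow> Re l < 0"
  shows "\<exists>b :: real^'n \<Rightarrow> real^'n \<Rightarrow> real. bilinear b \<and> (\<forall>x y. b x y = b y x) \<and>
    (\<forall>x. x \<noteq> 0 \<longrightarrow> b x x > 0) \<and> (\<forall>x. b x (M *v x) \<le> 0)"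
proof -
  obtain ks where ks: "\<And>x. shift_prod (cmatrix M) ks x = 0"
    using ex_annihilating_shifts[of "cmatrix M"] by blast
  define ls where "ls = filter (\<lambda>l. l \<in> eigenvalues (cmatrix M)) ks"
  have ls: "\<And>x. shift_prod (cmatrix M) ls x = 0" "set ls \<subseteq> eigenvalues (cmatrix M)"
    using shift_prod_drop_noneigenvalues[OF ks] by (auto simp: ls_def)
  have "\<exists>\<mu>>0. \<forall>l\<in>set ls. Re l \<le> - \<mu>"
  proof (cases "ls = []")
    case False
    define m where "m = Max (Re ` set ls)"
    have "m \<in> Re ` set ls" using False by (simp add: m_def)
    then have "m < 0" using stable ls(2) by auto
    moreover have "Re l \<le> m" if "l \<in> set ls" for l
      using that by (simp add: m_def)
    ultimately show ?thesis by (intro exI[of _ "- m"]) auto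
  qed (auto intro: exI[of _ 1])
  then obtain \<mu> where \<mu>: "\<mu> > 0" "\<And>l. l \<in> set ls \<Longrightarrow> Re l \<le> - \<mu>" by blast
  define b where "b x y = lyapunov_form (cmatrix M) \<mu> ls (cvec x) (cvec y)" for x y
  show ?thesis
  proof (intro exI[of _ b] conjI allI impI)
    show "bilinear b"
      using bilinear_compose[OF lyapunov_form_bilinear linear_cvec linear_cvec] by (simp add: b_def[abs_def])
    show "b x y = b y x" for x y
      by (simp add: b_def lyapunov_form_commute)
    show "b x x > 0" if "x \<noteq> 0" for x
    proof -
      have "ls \<noteq> []" using ls(1)[of "cvec x"] that by auto
      then obtain l ls' where "ls = l # ls'" by (cases ls) auto
      moreover have "cvec x \<bullet> cvec x > 0" using that by simp
      ultimately show ?thesis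
        by (auto simp: b_def lyapunov_form_nonneg intro!: add_pos_nonneg)
    qed
    show "b x (M *v x) \<le> 0" for x
      using lyapunov_form_decrease[OF \<mu> ls(1), of "cvec x"] \<mu>(1)
      by (auto simp: b_def cmatrix_cvec intro: order_trans)
  qed
qed

text \<open>If \<open>f\<close> is dissipative for some inner product \<open>b\<close>, then every solution \<open>p\<close> of the strict Lyapunov
  inequality for \<open>f\<close> is positive definite.\<close>

lemma lyapunov_positive:
  fixes f p :: "'a::euclidean_space \<Rightarrow> 'a" and b :: "'a \<Rightarrow> 'a \<Rightarrow> real"
  assumes b: "bilinear b" "\<And>x y. b x y = b y x" "\<And>x. x \<noteq> 0 \<Longrightarrow> b x x > 0" "\<And>x. b x (f x) \<le> 0"
    and p: "linear p" "\<And>x y. p x \<bullet> y = x \<bullet> p y" and neg: "\<And>x. x \<noteq> 0 \<Longrightarrow> x \<bullet> p (f x) < 0"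
    and "x \<noteq> 0"
  shows "x \<bullet> p x > 0"
proof -
  interpret b: bounded_bilinear b
    using b(1) by (simp add: bilinear_conv_bounded_bilinear)
  define r where "r x = (x \<bullet> p x) / b x x" for x
  have "sphere (0::'a) 1 \<noteq> {}"
    using \<open>x \<noteq> 0\<close> by (metis empty_iff mem_sphere_0 norm_sgn)
  moreover have "continuous_on (sphere 0 1) r"
  proof -
    have "\<forall>x\<in>sphere 0 1. b x x \<noteq> 0"
      using b(3) by (metis less_irrefl mem_sphere_0 norm_zero zero_neq_one)
    then show ?thesis
      unfolding r_def using p(1)
      by (intro continuous_intros b.continuous_on linear_continuous_on)
        (simp_all add: linear_conv_bounded_linear)
  qed
  ultimately obtain z where z: "norm z = 1" "\<And>y. norm y = 1 \<Longrightarrow> r z \<le> r y"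
    using continuous_attains_inf[of "sphere (0::'a) 1" r] by auto
  then have "z \<noteq> 0" by auto
  have min: "r z * b y y \<le> y \<bullet> p y" for y
  proof (cases "y = 0")
    case False
    have "r (y /\<^sub>R norm y) = r y"
      using False by (simp add: r_def b.scaleR_left b.scaleR_right linear_scale[OF p(1)])
    then have "r z \<le> r y" using z(2)[of "y /\<^sub>R norm y"] False by simp
    then show ?thesis using b(3)[OF False] by (simp add: r_def field_simps)
  qed (simp add: b.zero_left)
  have "r z > 0"
  proof (rule ccontr)
    assume "\<not> r z > 0"
    \<comment> \<open>The form \<open>h\<close> is nonnegative and vanishes at the minimizer \<open>z\<close>, hence \<open>h(z, f z) = 0\<close>; with
      \<open>r z \<le> 0\<close> this contradicts the two inequalities satisfied by \<open>f\<close>.\<close>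
    define h where "h x y = x \<bullet> p y - r z * b x y" for x y
    have "bilinear h"
      unfolding bilinear_def linear_iff h_def
      by (simp add: inner_add linear_add[OF p(1)] linear_scale[OF p(1)] b.add_left b.add_right
          b.scaleR_left b.scaleR_right algebra_simps)
    moreover have "h x y = h y x" for x y
      unfolding h_def using b(2)[of x y] p(2)[of x y] by (simp add: inner_commute)
    moreover have "h y y \<ge> 0" for y
      using min[of y] by (simp add: h_def)
    moreover have "h z z = 0"
      using b(3)[OF \<open>z \<noteq> 0\<close>] by (simp add: h_def r_def)
    ultimately have "h z (f z) = 0"
      using psd_form_null_vector[of h UNIV z "f z"] by simp
    then have "z \<bullet> p (f z) = r z * b z (f z)" by (simp add: h_def)
    also have "\<dots> \<ge> 0"
      using \<open>\<not> r z > 0\<close> b(4)[of z] by (simp add: mult_nonpos_nonpos)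
    finally show False using neg[OF \<open>z \<noteq> 0\<close>] by simp
  qed
  then have "0 < r z * b x x" using b(3)[OF \<open>x \<noteq> 0\<close>] by simp
  then show ?thesis using min[of x] by simp
qed

section \<open>Singular values and the frequency response\<close>

lemma inner_conj_transpose: "(conj_transpose T *v y) \<bullet> z = y \<bullet> (T *v z)"
proof -
  have *: "(cnj t * a) \<bullet> b = a \<bullet> (t * b)" for t a b :: complex
    by (simp add: inner_complex_def algebra_simps)
  have "(conj_transpose T *v y) \<bullet> z = (\<Sum>j\<in>UNIV. \<Sum>i\<in>UNIV. y $ i \<bullet> (T $ i $ j * z $ j))"
    by (simp add: inner_vec_def matrix_vector_mult_def conj_transpose_def inner_sum_left *)
  also have "\<dots> = (\<Sum>i\<in>UNIV. \<Sum>j\<in>UNIV. y $ i \<bullet> (T $ i $ j * z $ j))"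
    by (rule sum.swap)
  also have "\<dots> = y \<bullet> (T *v z)"
    by (simp add: inner_vec_def matrix_vector_mult_def inner_sum_right)
  finally show ?thesis .
qed

lemma linear_complex_matrix_mult: "linear ((*v) (T :: complex^'c^'r))"
  unfolding linear_iff of_real_vector_scalar_mult[symmetric]
  by (simp add: matrix_vector_right_distrib vector_scalar_commute)

lemma gram_inner: "x \<bullet> ((conj_transpose T ** T) *v x) = (norm (T *v x))\<^sup>2"
  by (simp add: matrix_vector_mul_assoc[symmetric] inner_commute[of x] inner_conj_transpose
      power2_norm_eq_inner)

lemma finite_singular_values: "finite (singular_values T)"
proof (rule finite_subset)
  show "singular_values T \<subseteq> (\<lambda>l. sqrt (Re l)) ` eigenvalues (conj_transpose T ** T)"
  proof
    fix s assume "s \<in> singular_values T"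
    then have "s = sqrt (Re (complex_of_real (s\<^sup>2)))" "complex_of_real (s\<^sup>2) \<in> eigenvalues (conj_transpose T ** T)"
      by (auto simp: singular_values_def)
    then show "s \<in> (\<lambda>l. sqrt (Re l)) ` eigenvalues (conj_transpose T ** T)" by blast
  qed
qed (simp add: finite_eigenvalues)

lemma norm_singular_vector:
  assumes "\<sigma> \<in> singular_values T"
  obtains v where "v \<noteq> 0" "norm (T *v v) = \<sigma> * norm v"
proof -
  obtain v where v: "\<sigma> \<ge> 0" "v \<noteq> 0" "(conj_transpose T ** T) *v v = complex_of_real (\<sigma>\<^sup>2) *s v"
    using assms by (auto simp: singular_values_def eigenvalues_def)
  have "(norm (T *v v))\<^sup>2 = (\<sigma> * norm v)\<^sup>2"
    unfolding gram_inner[symmetric] v(3) of_real_vector_scalar_mult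
    by (simp add: dot_square_norm power_mult_distrib)
  then have "norm (T *v v) = \<sigma> * norm v"
    using v(1) by (simp add: power2_eq_iff_nonneg)
  then show thesis using that v by blast
qed

text \<open>The top eigenvalue of the Gram matrix is the square of a singular value that bounds the operator norm.\<close>

lemma dominant_singular_value:
  obtains \<sigma> where "\<sigma> \<in> singular_values T" "\<And>x. norm (T *v x) \<le> \<sigma> * norm x"
proof -
  define f where "f x = (conj_transpose T ** T) *v x" for x
  have "linear f"
    unfolding f_def[abs_def] by (rule linear_complex_matrix_mult)
  moreover have "f x \<bullet> y = x \<bullet> f y" for x y
    unfolding f_def matrix_vector_mul_assoc[symmetric]
    by (simp add: inner_conj_transpose) (metis inner_commute inner_conj_transpose)
  ultimately obtain e where e: "norm e = 1" "f e = (e \<bullet> f e) *\<^sub>R e"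
    and bound: "\<And>x. x \<bullet> f x \<le> (e \<bullet> f e) * (norm x)\<^sup>2"
    using selfadjoint_eigenvector[of f UNIV] by (metis UNIV_I UNIV_not_singleton subspace_UNIV)
  define \<sigma> where "\<sigma> = norm (T *v e)"
  have s2: "e \<bullet> f e = \<sigma>\<^sup>2"
    by (simp add: f_def gram_inner \<sigma>_def)
  show thesis
  proof (rule that)
    have "e \<noteq> 0" using e(1) by auto
    then show "\<sigma> \<in> singular_values T"
      using e(2) unfolding s2 singular_values_def eigenvalues_def of_real_vector_scalar_mult[symmetric]
      by (auto simp: \<sigma>_def f_def)
    show "norm (T *v x) \<le> \<sigma> * norm x" for x
    proof (rule power2_le_imp_le)
      show "(norm (T *v x))\<^sup>2 \<le> (\<sigma> * norm x)\<^sup>2"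
        using bound[of x] unfolding s2 by (simp add: f_def gram_inner power_mult_distrib)
    qed (simp add: \<sigma>_def)
  qed
qed

lemma norm_le_sigma_max: "norm (T *v x) \<le> sigma_max T * norm x"
proof -
  obtain \<sigma> where \<sigma>: "\<sigma> \<in> singular_values T" "norm (T *v x) \<le> \<sigma> * norm x"
    using dominant_singular_value[of T] by metis
  have "\<sigma> \<le> sigma_max T"
    unfolding sigma_max_def using \<sigma>(1) by (simp add: finite_singular_values)
  then show ?thesis
    using \<sigma>(2) by (meson mult_right_mono norm_ge_zero order_trans)
qed

lemma sigma_max_le:
  assumes "\<And>x. norm (T *v x) \<le> c * norm x"
  shows "sigma_max T \<le> c"
proof -
  have "singular_values T \<noteq> {}"
    using dominant_singular_value[of T] by blast
  then have "sigma_max T \<in> singular_values T"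
    unfolding sigma_max_def by (simp add: finite_singular_values)
  then obtain v where "v \<noteq> 0" "norm (T *v v) = sigma_max T * norm v"
    by (rule norm_singular_vector)
  then show ?thesis using assms[of v] by simp
qed

lemma norm_vector_scalar_mult: "norm (s *s (x :: complex^'n)) = cmod s * norm x"
  by (simp add: norm_vec_def norm_mult L2_set_right_distrib)

lemma mat_scalar_mult_vec: "mat s *v x = s *s (x :: complex^'n)"
  by (simp add: vec_eq_iff matrix_vector_mult_def mat_def if_distrib[of "\<lambda>t. t * _"] cong: if_cong)

lemma norm_complex_matrix_mult_le: "\<exists>c>0. \<forall>x. norm ((T :: complex^'c^'r) *v x) \<le> c * norm x"
  using linear_bounded_pos[OF linear_complex_matrix_mult[of T]] by blast

text \<open>On the imaginary axis the resolvent of a stable matrix is uniformly bounded: by compactness for small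
  frequencies, and because \<open>\<i>\<omega>\<close> dominates \<open>M\<close> for large ones.\<close>

lemma resolvent_bound:
  fixes M :: "complex^'n^'n"
  assumes "\<And>l. l \<in> eigenvalues M \<Longrightarrow> Re l < 0"
  obtains \<kappa> where "\<kappa> > 0" "\<And>\<omega>::real. \<And>x. \<kappa> * norm x \<le> norm ((\<i> * complex_of_real \<omega>) *s x - M *v x)"
proof -
  obtain c where c: "c > 0" "\<And>x. norm (M *v x) \<le> c * norm x"
    using norm_complex_matrix_mult_le[of M] by blast
  define F where "F p = norm ((\<i> * complex_of_real (fst p)) *s snd p - M *v snd p)" for p :: "real \<times> (complex^'n)"
  define S where "S = {- (c + 1)..c + 1} \<times> sphere (0 :: complex^'n) 1"
  have compact: "compact S" by (simp add: S_def compact_Times)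
  have "0 \<in> {- (c + 1)..c + 1}" "axis undefined 1 \<in> sphere (0 :: complex^'n) 1"
    using c(1) by simp_all
  then have nonempty: "S \<noteq> {}"
    unfolding S_def by blast
  have cont: "continuous_on S F"
  proof -
    have "continuous_on UNIV ((*v) M)"
      using linear_complex_matrix_mult by (simp add: linear_continuous_on linear_conv_bounded_linear)
    then have "continuous_on S (\<lambda>p. M *v snd p)"
      by (rule continuous_on_compose2) (auto intro: continuous_intros)
    moreover have "continuous_on S (\<lambda>p. (\<i> * complex_of_real (fst p)) *s snd p)"
      unfolding vector_scalar_mult_def by (intro continuous_intros continuous_on_vec_lambda)
    ultimately show ?thesis unfolding F_def by (intro continuous_intros)
  qed
  obtain p where p: "p \<in> S" "\<And>q. q \<in> S \<Longrightarrow> F p \<le> F q"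
    using continuous_attains_inf[OF compact nonempty cont] by blast
  have pos: "F p > 0"
  proof (rule ccontr)
    assume "\<not> F p > 0"
    then have "M *v snd p = (\<i> * complex_of_real (fst p)) *s snd p"
      by (simp add: F_def)
    moreover have "snd p \<noteq> 0" using p(1) by (auto simp: S_def)
    ultimately show False
      using assms[of "\<i> * complex_of_real (fst p)"] by (auto simp: eigenvalues_def)
  qed
  show thesis
  proof (rule that)
    show "min (F p) 1 > 0" using pos by simp
    fix \<omega> :: real and x :: "complex^'n"
    show "min (F p) 1 * norm x \<le> norm ((\<i> * complex_of_real \<omega>) *s x - M *v x)"
    proof (cases "\<bar>\<omega>\<bar> \<le> c + 1 \<and> x \<noteq> 0")
      case True
      define y where "y = x /\<^sub>R norm x"
      have "F p \<le> F (\<omega>, y)"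
        using True by (intro p) (auto simp: S_def y_def)
      also have "\<dots> = norm ((1 / norm x) *\<^sub>R ((\<i> * complex_of_real \<omega>) *s x - M *v x))"
      proof -
        have "M *v y = (1 / norm x) *\<^sub>R (M *v x)"
          by (simp add: y_def linear_scale[OF linear_complex_matrix_mult] inverse_eq_divide)
        moreover have "(\<i> * complex_of_real \<omega>) *s y = (1 / norm x) *\<^sub>R ((\<i> * complex_of_real \<omega>) *s x)"
          by (simp add: y_def vec_eq_iff inverse_eq_divide)
        ultimately show ?thesis by (simp add: F_def scaleR_diff_right)
      qed
      also have "\<dots> = norm ((\<i> * complex_of_real \<omega>) *s x - M *v x) / norm x"
        by (simp only: norm_scaleR) simp
      finally have "F p * norm x \<le> norm ((\<i> * complex_of_real \<omega>) *s x - M *v x)"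
        using True by (simp add: pos_le_divide_eq)
      moreover have "min (F p) 1 * norm x \<le> F p * norm x"
        by (intro mult_right_mono) auto
      ultimately show ?thesis by linarith
    next
      case outside: False
      show ?thesis
      proof (cases "x = 0")
        case False
        with outside have "\<bar>\<omega>\<bar> \<ge> c + 1" by simp
        then have "(c + 1) * norm x \<le> \<bar>\<omega>\<bar> * norm x" by (intro mult_right_mono) auto
        also have "\<dots> = norm ((\<i> * complex_of_real \<omega>) *s x)"
          by (simp add: norm_vector_scalar_mult norm_mult)
        also have "\<dots> \<le> norm ((\<i> * complex_of_real \<omega>) *s x - M *v x) + norm (M *v x)"
          using norm_triangle_sub[of "(\<i> * complex_of_real \<omega>) *s x" "M *v x"] by simp
        finally have "norm x \<le> norm ((\<i> * complex_of_real \<omega>) *s x - M *v x)"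
          using c(2)[of x] by (simp add: algebra_simps)
        moreover have "min (F p) 1 * norm x \<le> 1 * norm x"
          by (intro mult_right_mono) auto
        ultimately show ?thesis by linarith
      qed simp
    qed
  qed
qed

lemma matrix_inv_right_left:
  fixes A :: "'a::semiring_1^'n^'n"
  assumes "invertible A"
  shows matrix_inv_right: "A ** matrix_inv A = mat 1" and matrix_inv_left: "matrix_inv A ** A = mat 1"
proof -
  have "A ** matrix_inv A = mat 1 \<and> matrix_inv A ** A = mat 1"
    using assms unfolding invertible_def matrix_inv_def by (rule someI_ex)
  then show "A ** matrix_inv A = mat 1" "matrix_inv A ** A = mat 1" by simp_all
qed

lemma norm_response_le_hinf_norm:
  fixes M Bw :: "real^'n^'n" and C :: "real^'n^'p"
  assumes stable: "\<And>l. l \<in> eigenvalues (cmatrix M) \<Longrightarrow> Re l < 0"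
    and eq: "(\<i> * complex_of_real \<omega>) *s x - cmatrix M *v x = cmatrix Bw *v w"
  shows "norm (cmatrix C *v x)
    \<le> hinf_norm (\<lambda>s. cmatrix C ** matrix_inv (mat s - cmatrix M) ** cmatrix Bw) * norm w"
proof -
  define N where "N \<omega> = mat (\<i> * complex_of_real \<omega>) - cmatrix M" for \<omega> :: real
  define T where "T s = cmatrix C ** matrix_inv (mat s - cmatrix M) ** cmatrix Bw" for s
  obtain \<kappa> where \<kappa>: "\<kappa> > 0"
    "\<And>\<omega>::real. \<And>x. \<kappa> * norm x \<le> norm ((\<i> * complex_of_real \<omega>) *s x - cmatrix M *v x)"
    using resolvent_bound[OF stable] by blast
  have N: "N \<omega> *v x = (\<i> * complex_of_real \<omega>) *s x - cmatrix M *v x" for \<omega> x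
    by (simp add: N_def matrix_vector_mult_diff_rdistrib mat_scalar_mult_vec)
  have inv: "invertible (N \<omega>)" for \<omega>
  proof -
    have "x = 0" if "N \<omega> *v x = 0" for x
    proof -
      have "\<kappa> * norm x \<le> 0" using \<kappa>(2)[of x \<omega>] that by (simp add: N)
      then show ?thesis using \<kappa>(1) by (simp add: mult_le_0_iff)
    qed
    then show ?thesis
      by (simp add: invertible_left_inverse matrix_left_invertible_ker)
  qed
  have invr: "N \<omega> *v (matrix_inv (N \<omega>) *v z) = z"
    and invl: "matrix_inv (N \<omega>) *v (N \<omega> *v z) = z" for \<omega> z
    by (simp_all add: matrix_vector_mul_assoc matrix_inv_right[OF inv] matrix_inv_left[OF inv])
  have Tw: "T (\<i> * complex_of_real \<omega>) *v w = cmatrix C *v (matrix_inv (N \<omega>) *v (cmatrix Bw *v w))" for \<omega> w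
    by (simp add: T_def N_def matrix_vector_mul_assoc matrix_mul_assoc)
  obtain c where c: "c > 0" "\<And>x. norm (cmatrix C *v x) \<le> c * norm x"
    using norm_complex_matrix_mult_le[of "cmatrix C"] by blast
  obtain b where b: "b > 0" "\<And>x. norm (cmatrix Bw *v x) \<le> b * norm x"
    using norm_complex_matrix_mult_le[of "cmatrix Bw"] by blast
  have bound: "sigma_max (T (\<i> * complex_of_real \<omega>)) \<le> c * (b / \<kappa>)" for \<omega>
  proof (rule sigma_max_le)
    fix w
    define y where "y = matrix_inv (N \<omega>) *v (cmatrix Bw *v w)"
    have "N \<omega> *v y = cmatrix Bw *v w"
      unfolding y_def by (rule invr)
    then have "\<kappa> * norm y \<le> b * norm w"
      using \<kappa>(2)[of y \<omega>] b(2)[of w] N[of \<omega> y] by simp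
    then have "norm y \<le> b / \<kappa> * norm w"
      using \<kappa>(1) by (simp add: field_simps)
    then have "c * norm y \<le> c * (b / \<kappa> * norm w)"
      using c(1) by (intro mult_left_mono) auto
    then show "norm (T (\<i> * complex_of_real \<omega>) *v w) \<le> c * (b / \<kappa>) * norm w"
      using c(2)[of y] unfolding Tw y_def[symmetric] by (simp add: mult.assoc)
  qed
  have "sigma_max (T (\<i> * complex_of_real \<omega>)) \<le> hinf_norm T"
    unfolding hinf_norm_def by (rule cSUP_upper) (auto intro!: bdd_aboveI2 bound)
  moreover have "cmatrix C *v x = T (\<i> * complex_of_real \<omega>) *v w"
    unfolding Tw eq[symmetric] N[symmetric]
    by (simp only: invl)
  ultimately show ?thesis
    using norm_le_sigma_max[of "T (\<i> * complex_of_real \<omega>)" w]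
    unfolding T_def[abs_def] by (metis (no_types, lifting) mult_right_mono norm_ge_zero order_trans)
qed

section \<open>Square roots of positive definite matrices\<close>

lemma symmetric_mat_inner: "symmetric_mat M \<Longrightarrow> (M *v x) \<bullet> y = x \<bullet> (M *v y)"
  by (metis dot_lmul_matrix inner_commute symmetric_mat_def transpose_matrix_vector)

lemma inner_transpose_mult: "y \<bullet> (transpose (M :: real^'n^'m) *v x) = (M *v y) \<bullet> x"
  unfolding transpose_matrix_vector by (metis dot_lmul_matrix inner_commute)

lemma symmetric_matI:
  assumes "\<And>x y. (M *v x) \<bullet> y = x \<bullet> (M *v y)"
  shows "symmetric_mat M"
proof -
  have "M $ i $ j = M $ j $ i" for i j
  proof -
    have entry: "axis i 1 \<bullet> (M *v axis j 1) = M $ i $ j" for i j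
      by (simp add: inner_axis' matrix_vector_mul_component inner_axis)
    show ?thesis
      using assms[of "axis j 1" "axis i 1"] entry[of i j] entry[of j i]
      by (metis inner_commute)
  qed
  then show ?thesis by (simp add: symmetric_mat_def transpose_def vec_eq_iff)
qed

text \<open>If \<open>S\<^sup>2 = T\<^sup>2\<close> then \<open>d = S - T\<close> satisfies \<open>S d + d T = 0\<close>. At an eigenvector \<open>e\<close> of \<open>d\<close> for an eigenvalue
  \<open>m \<noteq> 0\<close> this forces \<open>e \<bullet> S e = e \<bullet> T e = 0\<close>, but \<open>m = e \<bullet> S e - e \<bullet> T e\<close>.\<close>

lemma psd_sqrt_unique:
  fixes S T :: "real^'n^'n"
  assumes S: "pos_semidef S" and T: "pos_semidef T" and eq: "S ** S = T ** T"
  shows "S = T"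
proof -
  have Ssym: "(S *v x) \<bullet> y = x \<bullet> (S *v y)" and Tsym: "(T *v x) \<bullet> y = x \<bullet> (T *v y)" for x y
    using S T by (auto simp: pos_semidef_def intro!: symmetric_mat_inner)
  define d where "d x = S *v x - T *v x" for x
  have lin: "linear d"
    by (simp add: linear_iff d_def matrix_vector_right_distrib matrix_vector_mult_scaleR scaleR_diff_right)
  have sa: "d x \<bullet> y = x \<bullet> d y" for x y
    by (simp add: d_def inner_diff_left inner_diff_right Ssym Tsym)
  obtain E where E: "orthonormal_basis E" and eig: "\<And>e. e \<in> E \<Longrightarrow> d e = (e \<bullet> d e) *\<^sub>R e"
    using selfadjoint_eigenbasis[OF lin sa] by blast
  have zero: "d e = 0" if "e \<in> E" for e
  proof -
    define m where "m = e \<bullet> d e"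
    have de: "d e = m *\<^sub>R e" using eig[OF that] by (simp add: m_def)
    have SS: "S *v (S *v e) = T *v (T *v e)"
      by (simp add: matrix_vector_mul_assoc eq)
    have "(S *v e) \<bullet> d e + d e \<bullet> (T *v e) = 0"
      unfolding d_def inner_diff_left inner_diff_right
      using SS by (simp add: Ssym Tsym)
    then have "m * (e \<bullet> (S *v e) + e \<bullet> (T *v e)) = 0"
      by (simp add: de distrib_left inner_commute)
    moreover have "e \<bullet> (S *v e) \<ge> 0" "e \<bullet> (T *v e) \<ge> 0"
      using S T by (auto simp: pos_semidef_def)
    moreover have "m = e \<bullet> (S *v e) - e \<bullet> (T *v e)"
      by (simp add: m_def d_def inner_diff_right)
    ultimately have "m = 0" by auto
    then show ?thesis by (simp add: de)
  qed
  have "d x = 0" for x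
  proof -
    have "d x = d (\<Sum>e\<in>E. (e \<bullet> x) *\<^sub>R e)"
      by (simp add: orthonormal_basis_expansion[OF E])
    also have "\<dots> = 0"
      by (simp add: linear_sum[OF lin] linear_scale[OF lin] zero)
    finally show ?thesis .
  qed
  then show ?thesis by (simp add: d_def matrix_eq)
qed

lemma sqrt_mat_pos_def:
  assumes "pos_def Q"
  shows "pos_semidef (sqrt_mat Q)" and "sqrt_mat Q ** sqrt_mat Q = Q"
proof -
  have "pos_semidef (sqrt_mat Q) \<and> sqrt_mat Q ** sqrt_mat Q = Q"
    unfolding sqrt_mat_def
  proof (rule theI')
    have sym: "(Q *v x) \<bullet> y = x \<bullet> (Q *v y)" and pos: "x \<noteq> 0 \<Longrightarrow> x \<bullet> (Q *v x) > 0" for x y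
      using assms by (auto simp: pos_def_def intro!: symmetric_mat_inner)
    obtain s t where s: "linear s" "\<And>x y. s x \<bullet> y = x \<bullet> s y" "\<And>x. x \<bullet> s x \<ge> 0" "\<And>x. s (s x) = Q *v x"
      and "linear t" "\<And>x y. t x \<bullet> y = x \<bullet> t y" "\<And>x. s (t x) = x" "\<And>x. t (s x) = x"
      using selfadjoint_sqrt[OF matrix_vector_mul_linear[of Q] sym pos] by blast
    have ms: "matrix s *v x = s x" for x
      using s(1) by (simp add: matrix_works)
    have "pos_semidef (matrix s)"
      using s by (auto simp: pos_semidef_def ms intro!: symmetric_matI)
    moreover have "matrix s ** matrix s = Q"
      by (simp add: matrix_eq matrix_vector_mul_assoc[symmetric] ms s)
    ultimately show "\<exists>!S. pos_semidef S \<and> S ** S = Q"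
      using psd_sqrt_unique by (intro ex1I[of _ "matrix s"]) auto
  qed
  then show "pos_semidef (sqrt_mat Q)" "sqrt_mat Q ** sqrt_mat Q = Q" by auto
qed

section \<open>The bounded real lemma\<close>

text \<open>The complex vector \<open>a + \<i>b\<close>.\<close>

definition cplx_vec :: "real^'n \<Rightarrow> real^'n \<Rightarrow> complex^'n" where
  "cplx_vec a b = (\<chi> i. Complex (a $ i) (b $ i))"

lemma cmatrix_cplx_vec: "cmatrix M *v cplx_vec a b = cplx_vec (M *v a) (M *v b)"
  by (simp add: vec_eq_iff cmatrix_def map_matrix_def cplx_vec_def matrix_vector_mult_def complex_eq_iff)

lemma norm_cplx_vec: "(norm (cplx_vec a b))\<^sup>2 = (norm a)\<^sup>2 + (norm b)\<^sup>2"
  by (simp add: power2_norm_eq_inner inner_vec_def cplx_vec_def inner_complex_def sum.distrib)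

lemma imaginary_cplx_vec: "(\<i> * complex_of_real w) *s cplx_vec a b = cplx_vec (- w *\<^sub>R b) (w *\<^sub>R a)"
  by (simp add: vec_eq_iff cplx_vec_def complex_eq_iff)

lemma diff_cplx_vec: "cplx_vec a b - cplx_vec c d = cplx_vec (a - c) (b - d)"
  by (simp add: vec_eq_iff cplx_vec_def complex_eq_iff)

text \<open>The bounded real lemma at the value of the norm, for an invertible input matrix and an injective
  output matrix.\<close>

lemma bounded_real_lemma:
  fixes M Bw D :: "real^'n^'n" and C :: "real^'n^'p"
  defines "g \<equiv> hinf_norm (\<lambda>s. cmatrix C ** matrix_inv (mat s - cmatrix M) ** cmatrix Bw)"
  assumes stable: "\<And>l. l \<in> eigenvalues (cmatrix M) \<Longrightarrow> Re l < 0"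
    and D: "Bw ** D = mat 1"
    and C: "\<And>x. C *v x = 0 \<Longrightarrow> x = 0"
  shows "g > 0" and "\<exists>P. pos_def P \<and>
    (\<forall>x w. 2 * ((M *v x + Bw *v w) \<bullet> (P *v x)) + (norm (C *v x))\<^sup>2 / g \<le> g * (norm w)\<^sup>2)"
proof -
  have freq: "(norm (C *v a))\<^sup>2 + (norm (C *v b))\<^sup>2
      \<le> g\<^sup>2 * ((norm (D *v (- w *\<^sub>R b - M *v a)))\<^sup>2 + (norm (D *v (w *\<^sub>R a - M *v b)))\<^sup>2)"
    and freq': "norm (cplx_vec (C *v a) (C *v b))
      \<le> g * norm (cplx_vec (D *v (- w *\<^sub>R b - M *v a)) (D *v (w *\<^sub>R a - M *v b)))" for a b w
  proof -
    \<comment> \<open>The input that produces the state \<open>a + \<i>b\<close> at frequency \<open>w\<close>.\<close>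
    let ?w = "cplx_vec (D *v (- w *\<^sub>R b - M *v a)) (D *v (w *\<^sub>R a - M *v b))"
    have "(\<i> * complex_of_real w) *s cplx_vec a b - cmatrix M *v cplx_vec a b = cmatrix Bw *v ?w"
      by (simp only: cmatrix_cplx_vec imaginary_cplx_vec diff_cplx_vec matrix_vector_mul_assoc D matrix_vector_mul_lid)
    from norm_response_le_hinf_norm[OF stable this, of C]
    show *: "norm (cplx_vec (C *v a) (C *v b)) \<le> g * norm ?w"
      by (simp add: g_def cmatrix_cplx_vec)
    then have "(norm (cplx_vec (C *v a) (C *v b)))\<^sup>2 \<le> (g * norm ?w)\<^sup>2"
      by (rule power_mono) simp
    then show "(norm (C *v a))\<^sup>2 + (norm (C *v b))\<^sup>2
      \<le> g\<^sup>2 * ((norm (D *v (- w *\<^sub>R b - M *v a)))\<^sup>2 + (norm (D *v (w *\<^sub>R a - M *v b)))\<^sup>2)"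
      by (simp add: norm_cplx_vec power_mult_distrib)
  qed
  show g: "g > 0"
  proof -
    \<comment> \<open>At frequency \<open>0\<close> an arbitrary nonzero state gives a nonzero response.\<close>
    have "(axis undefined 1 :: real^'n) \<noteq> 0" by simp
    then have "C *v axis undefined 1 \<noteq> 0" using C by blast
    then have "(norm (cplx_vec (C *v axis undefined 1) (C *v 0)))\<^sup>2 > 0"
      by (simp add: norm_cplx_vec)
    then have "norm (cplx_vec (C *v axis undefined 1) (C *v 0)) > 0"
      by (metis norm_eq_zero zero_less_norm_iff zero_less_power2)
    from this freq'[of "axis undefined 1" 0 0] have "0 < g * norm (cplx_vec (D *v (- 0 *\<^sub>R 0 - M *v axis undefined 1))
        (D *v (0 *\<^sub>R axis undefined 1 - M *v 0)))"
      by (rule less_le_trans)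
    then show ?thesis by (simp add: zero_less_mult_iff)
  qed
  \<comment> \<open>The variable \<open>v = M x + B\<^sub>w w\<close> replaces \<open>w\<close>, which is recovered as \<open>D (v - M x)\<close>.\<close>
  define L where "L z = D *v (snd z - M *v fst z)" for z
  define N where "N z = C *v fst z" for z :: "(real^'n) \<times> (real^'n)"
  have L: "linear L" and N: "linear N"
    by (auto simp: linear_iff L_def N_def matrix_vector_right_distrib matrix_vector_mult_diff_distrib
        matrix_vector_mult_scaleR algebra_simps)
  define h where "h z z' = g * (L z \<bullet> L z') - (N z \<bullet> N z') / g" for z z'
  have h: "bilinear h"
    unfolding bilinear_def linear_iff h_def
    by (simp add: linear_add[OF L] linear_add[OF N] linear_scale[OF L] linear_scale[OF N] inner_add
        algebra_simps add_divide_distrib)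
  have hq: "h (x, v) (x, v) = g * (norm (D *v (v - M *v x)))\<^sup>2 - (norm (C *v x))\<^sup>2 / g" for x v
    by (simp add: h_def L_def N_def power2_norm_eq_inner)
  have "h z z' = h z' z" for z z'
    by (simp add: h_def inner_commute)
  moreover have "h (0, v) (0, v) \<ge> 0" for v
    using g by (simp add: hq)
  moreover have "h (x, - w *\<^sub>R y) (x, - w *\<^sub>R y) + h (y, w *\<^sub>R x) (y, w *\<^sub>R x) \<ge> 0" for w x y
  proof -
    have "((norm (C *v x))\<^sup>2 + (norm (C *v y))\<^sup>2) / g
      \<le> g\<^sup>2 * ((norm (D *v (- w *\<^sub>R y - M *v x)))\<^sup>2 + (norm (D *v (w *\<^sub>R x - M *v y)))\<^sup>2) / g"
      using freq g by (intro divide_right_mono) auto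
    also have "\<dots> = g * ((norm (D *v (- w *\<^sub>R y - M *v x)))\<^sup>2 + (norm (D *v (w *\<^sub>R x - M *v y)))\<^sup>2)"
      using g by (simp add: power2_eq_square)
    finally show ?thesis unfolding hq by (simp add: algebra_simps add_divide_distrib)
  qed
  ultimately obtain P' where P': "transpose P' = P'" "\<And>x v. h (x, v) (x, v) + 2 * (v \<bullet> (P' *v x)) \<ge> 0"
    using kyp_lemma[OF h] by blast
  define P where "P = - P'"
  have P: "symmetric_mat P" "\<And>x v. 2 * (v \<bullet> (P *v x)) \<le> h (x, v) (x, v)"
  proof -
    show "symmetric_mat P"
      using P'(1) by (simp add: symmetric_mat_def P_def transpose_def vec_eq_iff)
    show "2 * (v \<bullet> (P *v x)) \<le> h (x, v) (x, v)" for x v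
    proof -
      have "P *v x = - (P' *v x)"
        using scaleR_matrix_vector_assoc[of "- 1" P' x] by (simp add: P_def)
      then show ?thesis using P'(2)[of x v] by simp
    qed
  qed
  note Psym = symmetric_mat_inner[OF P(1)]
  have "pos_def P"
  proof -
    obtain b :: "real^'n \<Rightarrow> real^'n \<Rightarrow> real" where b: "bilinear b" "\<And>x y. b x y = b y x" "\<And>x. x \<noteq> 0 \<Longrightarrow> b x x > 0" "\<And>x. b x (M *v x) \<le> 0"
      using ex_lyapunov_form[of M] stable by blast
    have "x \<bullet> (P *v (M *v x)) < 0" if "x \<noteq> 0" for x
    proof -
      have "C *v x \<noteq> 0" using C that by blast
      then have "(norm (C *v x))\<^sup>2 / g > 0" using g by simp
      then show ?thesis
        using P(2)[of "M *v x" x] Psym[of x "M *v x"] by (simp add: hq inner_commute)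
    qed
    from lyapunov_positive[OF b matrix_vector_mul_linear Psym this] P(1) show ?thesis
      by (auto simp: pos_def_def)
  qed
  moreover have "2 * ((M *v x + Bw *v w) \<bullet> (P *v x)) + (norm (C *v x))\<^sup>2 / g \<le> g * (norm w)\<^sup>2" for x w
  proof -
    have "D ** Bw = mat 1" using D by (simp add: matrix_left_right_inverse)
    then have "D *v (M *v x + Bw *v w - M *v x) = w"
      by (simp add: matrix_vector_mul_assoc)
    then show ?thesis using P(2)[of "M *v x + Bw *v w" x] by (simp add: hq)
  qed
  ultimately show "\<exists>P. pos_def P \<and>
    (\<forall>x w. 2 * ((M *v x + Bw *v w) \<bullet> (P *v x)) + (norm (C *v x))\<^sup>2 / g \<le> g * (norm w)\<^sup>2)" by blast
qed

section \<open>Block matrices and the linear matrix inequality\<close>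

text \<open>The two blocks of a vector indexed by a sum type.\<close>

definition upper :: "'e^('a::finite + 'b::finite) \<Rightarrow> 'e^'a" where "upper v = (\<chi> i. v $ Inl i)"
definition lower :: "'e^('a::finite + 'b::finite) \<Rightarrow> 'e^'b" where "lower v = (\<chi> i. v $ Inr i)"

lemma sum_UNIV_sum: "(\<Sum>k\<in>(UNIV :: ('a::finite + 'b::finite) set). f k) = (\<Sum>i\<in>UNIV. f (Inl i)) + (\<Sum>j\<in>UNIV. f (Inr j))"
  unfolding UNIV_Plus_UNIV[symmetric] by (subst sum.Plus) simp_all

lemma hcat_mult: "(M ||| N) *v v = M *v upper v + N *v lower v"
  by (simp add: vec_eq_iff hcat_def matrix_vector_mult_def sum_UNIV_sum upper_def lower_def)

lemma upper_vcat_mult: "upper ((M === N) *v v) = M *v v"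
  and lower_vcat_mult: "lower ((M === N) *v v) = N *v v"
  by (simp_all add: vec_eq_iff vcat_def matrix_vector_mult_def upper_def lower_def)

lemma inner_sum_vec: "(x :: real^('a::finite + 'b::finite)) \<bullet> y = upper x \<bullet> upper y + lower x \<bullet> lower y"
  by (simp add: inner_vec_def sum_UNIV_sum upper_def lower_def)

lemma inner_vcat_mult: "(x :: real^('a::finite + 'b::finite)) \<bullet> ((M === N) *v v) = upper x \<bullet> (M *v v) + lower x \<bullet> (N *v v)"
  by (simp add: inner_sum_vec upper_vcat_mult lower_vcat_mult)

lemma norm_vcat_mult: "(norm ((M === N) *v (v :: real^'n)))\<^sup>2 = (norm (M *v v))\<^sup>2 + (norm (N *v v))\<^sup>2"
  by (simp add: power2_norm_eq_inner inner_sum_vec upper_vcat_mult lower_vcat_mult)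

lemma cmatrix_add: "cmatrix (A + B) = cmatrix A + cmatrix B"
  by (simp add: cmatrix_def map_matrix_def vec_eq_iff)

lemma cmatrix_mult: "cmatrix (A ** B) = cmatrix A ** cmatrix B"
  by (simp add: cmatrix_def map_matrix_def vec_eq_iff matrix_matrix_mult_def)

lemma inner_le_norm_squares:
  assumes "g > 0"
  shows "2 * (x \<bullet> y) \<le> g * (norm x)\<^sup>2 + (norm y)\<^sup>2 / g"
proof -
  have "(norm (g *\<^sub>R x - y))\<^sup>2 = g\<^sup>2 * (norm x)\<^sup>2 + (norm y)\<^sup>2 - 2 * g * (x \<bullet> y)"
    unfolding power2_norm_eq_inner
    by (simp add: inner_diff inner_commute power2_eq_square algebra_simps)
  moreover have "0 \<le> (norm (g *\<^sub>R x - y))\<^sup>2 / g" using assms by simp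
  moreover have "(g\<^sup>2 * (norm x)\<^sup>2 + (norm y)\<^sup>2 - 2 * g * (x \<bullet> y)) / g
      = g * (norm x)\<^sup>2 + (norm y)\<^sup>2 / g - 2 * (x \<bullet> y)"
    using assms by (simp add: field_simps power2_eq_square)
  ultimately show ?thesis by simp
qed

theorem proposition4p3:
  fixes A Bw Q :: "real^'n^'n" and B :: "real^'m^'n" and R :: "real^'m^'m"
  assumes "controllable A B"
    and "observable (sqrt_mat Q) A"
    and "rank Bw = CARD('n)"
    and "pos_def Q"
    and "pos_def R"
  shows "\<forall>K \<in> stabilizing A B. nondegenerate (ecl_inf A B Bw Q R) (J_inf A B Bw Q R) K"
proof
  fix K assume K: "K \<in> stabilizing A B"
  define M where "M = A + B ** K"
  define S where "S = sqrt_mat Q"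
  define W where "W = sqrt_mat R"
  define C where "C = S === W ** K"
  define g where "g = J_inf A B Bw Q R K"
  have stable: "Re l < 0" if "l \<in> eigenvalues (cmatrix M)" for l
  proof -
    have "Re l \<le> spectral_abscissa M"
      unfolding spectral_abscissa_def using that by (simp add: finite_eigenvalues)
    also have "\<dots> < 0" using K by (simp add: stabilizing_def M_def)
    finally show ?thesis .
  qed
  have Ssym: "transpose S = S" and Wsym: "transpose W = W"
    using sqrt_mat_pos_def(1) assms(4,5) by (auto simp: S_def W_def pos_semidef_def symmetric_mat_def)
  have SS: "S ** S = Q"
    using sqrt_mat_pos_def(2) assms(4) by (simp add: S_def)
  obtain D where D: "Bw ** D = mat 1"
    using assms(3) full_rank_surjective[of Bw] matrix_right_invertible_surjective[of Bw] by auto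
  have C0: "x = 0" if "C *v x = 0" for x
  proof (rule ccontr)
    assume "x \<noteq> 0"
    have "S *v x = 0"
      using that upper_vcat_mult[of S "W ** K" x] by (simp add: C_def upper_def vec_eq_iff)
    then have "Q *v x = 0" by (simp add: SS[symmetric] matrix_vector_mul_assoc[symmetric])
    then show False using assms(4) \<open>x \<noteq> 0\<close> by (force simp: pos_def_def)
  qed
  have g_eq: "g = hinf_norm (\<lambda>s. cmatrix C ** matrix_inv (mat s - cmatrix M) ** cmatrix Bw)"
    unfolding g_def J_inf_def T_zw_def[abs_def] C_def S_def W_def M_def cmatrix_add cmatrix_mult
    by (simp add: diff_diff_eq)
  have g: "g > 0"
    using bounded_real_lemma(1)[OF stable D C0] by (simp add: g_eq)
  obtain P where P: "pos_def P"
    and riccati: "\<And>x w. 2 * ((M *v x + Bw *v w) \<bullet> (P *v x)) + (norm (C *v x))\<^sup>2 / g \<le> g * (norm w)\<^sup>2"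
    using bounded_real_lemma(2)[OF stable D C0] unfolding g_eq by blast
  have Psym: "transpose P = P"
    using P by (simp add: pos_def_def symmetric_mat_def)
  let ?F = "(transpose M ** P + P ** M ||| P ** Bw ||| S ||| transpose K ** W)
    === (transpose Bw ** P ||| (- g) *\<^sub>R mat 1 ||| 0 ||| 0)
    === (S ||| 0 ||| (- g) *\<^sub>R mat 1 ||| 0)
    === (W ** K ||| 0 ||| 0 ||| (- g) *\<^sub>R mat 1)"
  have scale: "- (g *\<^sub>R mat 1) *v y = - (g *\<^sub>R y)" for y :: "real^'k"
    using scaleR_matrix_vector_assoc[of "- g" "mat 1" y] by simp
  have swap: "x \<bullet> (N *v y) = y \<bullet> (N *v x)" if "transpose N = N" for N :: "real^'k^'k" and x y
    using symmetric_mat_inner[of N x y] that by (simp add: symmetric_mat_def inner_commute)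
  note swaps = swap[OF Psym] swap[OF Ssym] swap[OF Wsym]
  \<comment> \<open>The blocks \<open>x\<close>, \<open>w\<close>, \<open>y\<close>, \<open>u\<close> of \<open>\<zeta>\<close> are \<open>upper \<zeta>\<close>, \<open>upper (lower \<zeta>)\<close>, \<open>upper (lower (lower \<zeta>))\<close> and
    \<open>lower (lower (lower \<zeta>))\<close>.\<close>
  have F: "\<zeta> \<bullet> (?F *v \<zeta>') =
    (M *v upper \<zeta>) \<bullet> (P *v upper \<zeta>') + upper \<zeta> \<bullet> (P *v (M *v upper \<zeta>')) + upper \<zeta> \<bullet> (P *v (Bw *v upper (lower \<zeta>')))
    + upper \<zeta> \<bullet> (S *v upper (lower (lower \<zeta>'))) + (K *v upper \<zeta>) \<bullet> (W *v lower (lower (lower \<zeta>')))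
    + (Bw *v upper (lower \<zeta>)) \<bullet> (P *v upper \<zeta>') - g * (upper (lower \<zeta>) \<bullet> upper (lower \<zeta>'))
    + upper (lower (lower \<zeta>)) \<bullet> (S *v upper \<zeta>') - g * (upper (lower (lower \<zeta>)) \<bullet> upper (lower (lower \<zeta>')))
    + lower (lower (lower \<zeta>)) \<bullet> (W *v (K *v upper \<zeta>')) - g * (lower (lower (lower \<zeta>)) \<bullet> lower (lower (lower \<zeta>')))" for \<zeta> \<zeta>'
    by (simp add: inner_vcat_mult hcat_mult matrix_vector_mult_add_rdistrib scale inner_add_right inner_diff_right
        matrix_vector_mul_assoc[symmetric] inner_transpose_mult
        del: transpose_matrix_vector)
  have "symmetric_mat ?F"
  proof (rule symmetric_matI)
    fix x y
    have "y \<bullet> (?F *v x) = x \<bullet> (?F *v y)"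
      unfolding F inner_commute[of "upper (lower y)" "upper (lower x)"]
        inner_commute[of "upper (lower (lower y))" "upper (lower (lower x))"]
        inner_commute[of "lower (lower (lower y))" "lower (lower (lower x))"]
      by (simp add: swaps)
    then show "(?F *v x) \<bullet> y = x \<bullet> (?F *v y)"
      by (simp only: inner_commute[of "?F *v x"])
  qed
  moreover have "\<zeta> \<bullet> (?F *v \<zeta>) \<le> 0" for \<zeta>
  proof -
    define x where "x = upper \<zeta>"
    define w where "w = upper (lower \<zeta>)"
    define y where "y = upper (lower (lower \<zeta>))"
    define u where "u = lower (lower (lower \<zeta>))"
    have "\<zeta> \<bullet> (?F *v \<zeta>) = 2 * ((M *v x + Bw *v w) \<bullet> (P *v x)) + 2 * (y \<bullet> (S *v x)) + 2 * (u \<bullet> (W *v (K *v x)))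
      - g * (norm w)\<^sup>2 - g * (norm y)\<^sup>2 - g * (norm u)\<^sup>2"
      unfolding F x_def[symmetric] w_def[symmetric] y_def[symmetric] u_def[symmetric]
      by (simp add: swaps power2_norm_eq_inner inner_add_right matrix_vector_right_distrib)
    \<comment> \<open>Completing squares eliminates \<open>y\<close> and \<open>u\<close>.\<close>
    moreover have "2 * (y \<bullet> (S *v x)) \<le> g * (norm y)\<^sup>2 + (norm (S *v x))\<^sup>2 / g"
      "2 * (u \<bullet> (W *v (K *v x))) \<le> g * (norm u)\<^sup>2 + (norm (W *v (K *v x)))\<^sup>2 / g"
      using g by (rule inner_le_norm_squares)+
    moreover have "(norm (C *v x))\<^sup>2 / g = (norm (S *v x))\<^sup>2 / g + (norm (W *v (K *v x)))\<^sup>2 / g"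
      by (simp add: C_def norm_vcat_mult matrix_vector_mul_assoc add_divide_distrib)
    ultimately show ?thesis using riccati[of x w] by linarith
  qed
  ultimately have "(K, g, P) \<in> L_inf A B Bw Q R"
    using P by (simp add: L_inf_def neg_semidef_def M_def S_def W_def)
  then show "nondegenerate (ecl_inf A B Bw Q R) (J_inf A B Bw Q R) K"
    unfolding nondegenerate_def ecl_inf_def g_def by (force simp: image_iff)
qed

end
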